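(* Let $D=\{x\in\mathbb{R}^m:\|x\|_\infty\le\rho\}$, $r\ge1$, let $B_0,\ldots,B_N$ be real $d\times d$ matrices with $B_0$ invertible, and let $\Lambda$ be a real $m\times m$ matrix. Suppose there is a real number $\mu$ with (1) $\|\Lambda\|^r\le\mu<1$, and (2) $\sum_{i=1}^N\mu^i\|B_0^{-1}B_i\|<1$. Then the linear operator $\mathcal{L}:H_r\to H_r$, $\mathcal{L}\varphi=\sum_{j=0}^NB_j(\varphi\circ\Lambda^j)$, is well defined and invertible with bounded inverse.
   Context: $\|\cdot\|_\infty$ is the sup norm on $\mathbb{R}^m$ and $\mathbb{R}^d$; matrix norms are the corresponding operator norms. For a $k$-linear map $B$, $\|B\|=\sup\{\|B(\xi_1,\ldots,\xi_k)\|_\infty:\|\xi_i\|_\infty=1\}$. $H_r=\{P\in C^r(D,\mathbb{R}^d): D^iP(0)=0 \text{ for } 0\le i\le r-1\}$, a Banach space with the norm $\|P\|'_r=\sup_{x\in D}\|D^rP(x)\|$. ($\mathcal{L}$ is the derivative at $0$ of the parameterization operator $\Phi(P)(z)=Z(P(z),P(\Lambda z),\ldots,P(\Lambda^Nz))$ when $B_j=\partial_jZ(0)$.) *)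

theory Defs
  imports "HOL-Analysis.Analysis"
begin

text \<open>Sup norm on real vectors (the dimension is the finite index type).\<close>
definition supn :: "real^'n \<Rightarrow> real" where
  "supn x = Max (range (\<lambda>i. \<bar>x $ i\<bar>))"

text \<open>Operator norm of a matrix w.r.t. the sup norm.\<close>
definition opnorm_inf :: "real^'n^'k \<Rightarrow> real" where
  "opnorm_inf A = (SUP x \<in> {x. supn x = 1}. supn (A *v x))"

text \<open>Norm of a k-linear map T, represented as a function of a direction
  sequence xi (only xi 0, ..., xi (k-1) matter).\<close>
definition mlnorm :: "nat \<Rightarrow> ((nat \<Rightarrow> real^'m) \<Rightarrow> real^'d) \<Rightarrow> real" where
  "mlnorm k T = (SUP xi \<in> {xi. \<forall>i<k. supn (xi i) = 1}. supn (T xi))"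

text \<open>The closed sup-norm ball D of radius rho.\<close>
definition Dset :: "real \<Rightarrow> (real^'m) set" where
  "Dset \<rho> = {x. supn x \<le> \<rho>}"

text \<open>Iterated Frechet derivative relative to the set S:
  dd S k f xi x = D^k f(x)(xi 0, ..., xi (k-1)).\<close>
fun dd :: "(real^'m) set \<Rightarrow> nat \<Rightarrow> (real^'m \<Rightarrow> real^'d) \<Rightarrow> (nat \<Rightarrow> real^'m) \<Rightarrow> real^'m \<Rightarrow> real^'d" where
  "dd S 0 f xi x = f x"
| "dd S (Suc k) f xi x = frechet_derivative (\<lambda>y. dd S k f xi y) (at x within S) (xi k)"

text \<open>f is C^r on S: the derivatives D^k f (k < r) are differentiable on S and
  D^r f is continuous on S in the multilinear operator norm.\<close>
definition Cr_on :: "(real^'m) set \<Rightarrow> nat \<Rightarrow> (real^'m \<Rightarrow> real^'d) \<Rightarrow> bool" where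
  "Cr_on S r f \<longleftrightarrow>
     (\<forall>k<r. \<forall>xi. \<forall>x\<in>S. (\<lambda>y. dd S k f xi y) differentiable (at x within S)) \<and>
     (\<forall>x\<in>S. ((\<lambda>y. mlnorm r (\<lambda>xi. dd S r f xi y - dd S r f xi x)) \<longlongrightarrow> 0) (at x within S))"

text \<open>The space H_r. Elements are functions on D; we represent them as total
  functions vanishing outside D (so that equality in H_r is equality of functions).\<close>
definition Hr :: "real \<Rightarrow> nat \<Rightarrow> (real^'m \<Rightarrow> real^'d) set" where
  "Hr \<rho> r = {P. Cr_on (Dset \<rho>) r P \<and> (\<forall>x. x \<notin> Dset \<rho> \<longrightarrow> P x = 0) \<and>
                 (\<forall>i<r. \<forall>xi. dd (Dset \<rho>) i P xi 0 = 0)}"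

text \<open>The norm of H_r: sup over D of the norm of D^r P(x).\<close>
definition Hnorm :: "real \<Rightarrow> nat \<Rightarrow> (real^'m \<Rightarrow> real^'d) \<Rightarrow> real" where
  "Hnorm \<rho> r P = (SUP x \<in> Dset \<rho>. mlnorm r (\<lambda>xi. dd (Dset \<rho>) r P xi x))"

text \<open>The operator L phi = sum_{j=0}^N B_j (phi o Lambda^j), on D (zero outside D).\<close>
definition Lop :: "real \<Rightarrow> nat \<Rightarrow> (nat \<Rightarrow> real^'d^'d) \<Rightarrow> real^'m^'m
                   \<Rightarrow> (real^'m \<Rightarrow> real^'d) \<Rightarrow> real^'m \<Rightarrow> real^'d" where
  "Lop \<rho> N B \<Lambda> \<phi> x =
     (if x \<in> Dset \<rho> then (\<Sum>j=0..N. B j *v \<phi> (((*v) \<Lambda> ^^ j) x)) else 0)"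

end

theory Submission
  imports Defs
begin

text \<open>
  Theorem 13: under \<open>\<parallel>\<Lambda>\<parallel>\<^sup>r \<le> \<mu> < 1\<close> and \<open>\<kappa> = \<Sum>\<^sub>i\<^sub>=\<^sub>1\<^sub>.\<^sub>.\<^sub>N \<mu>\<^sup>i \<parallel>B\<^sub>0\<^sup>-\<^sup>1B\<^sub>i\<parallel> < 1\<close>
  the operator \<open>L\<phi> = \<Sum>\<^sub>j B\<^sub>j (\<phi> \<circ> \<Lambda>\<^sup>j)\<close> is a bounded bijection of \<open>H\<^sub>r\<close>.

  Idea: \<open>L\<phi> = B\<^sub>0(\<phi> + K\<phi>)\<close> with \<open>K\<phi> = \<Sum>\<^sub>j\<^sub>\<ge>\<^sub>1 B\<^sub>0\<^sup>-\<^sup>1B\<^sub>j (\<phi> \<circ> \<Lambda>\<^sup>j)\<close>. Precomposition with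
  \<open>\<Lambda>\<^sup>j\<close> multiplies the \<open>H\<^sub>r\<close>-norm (the supremum of \<open>\<parallel>D\<^sup>r\<phi>\<parallel>\<close> over \<open>D\<close>) by at most
  \<open>\<parallel>\<Lambda>\<parallel>\<^sup>j\<^sup>r \<le> \<mu>\<^sup>j\<close>, so \<open>\<parallel>K\<parallel> \<le> \<kappa> < 1\<close> and \<open>L\<phi> = \<psi>\<close> is the fixed point equation
  \<open>\<phi> = B\<^sub>0\<^sup>-\<^sup>1\<psi> - K\<phi>\<close> of a contraction of the complete space \<open>H\<^sub>r\<close>.

  Structure: (1) sup norm, operator norm and multilinear maps; (2) calculus of the iterated
  derivative \<open>dd\<close> on the box \<open>D\<close>; (3) \<open>H\<^sub>r\<close> is closed under weighted composition sums
  \<open>\<Sum>\<^sub>j A\<^sub>j (f\<^sub>j \<circ> T\<^sub>j)\<close>, with a matching norm bound, which covers \<open>L\<close>, \<open>K\<close> and differences;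
  (4) the \<open>H\<^sub>r\<close>-norm is definite, by the mean value inequality and \<open>D\<^sup>k\<phi>(0) = 0\<close> for \<open>k < r\<close>,
  and \<open>H\<^sub>r\<close> is complete; (5) Banach's fixed point theorem for a set with a complete distance;
  (6) unique solvability of \<open>L\<phi> = \<psi>\<close> with \<open>\<parallel>\<phi>\<parallel> \<le> \<parallel>B\<^sub>0\<^sup>-\<^sup>1\<parallel> \<parallel>\<psi>\<parallel> / (1 - \<kappa>)\<close>, and the theorem.
\<close>

text \<open>Elementary properties of the sup norm \<open>supn\<close>.\<close>

lemma supn_ge: "\<bar>x $ i\<bar> \<le> supn x"
  unfolding supn_def by (rule Max_ge) auto

lemma supn_le_iff: "supn x \<le> b \<longleftrightarrow> (\<forall>i. \<bar>x $ i\<bar> \<le> b)"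
  unfolding supn_def by (subst Max_le_iff) auto

lemma supn_nonneg: "0 \<le> supn x"
  using supn_ge[of x undefined] by linarith

lemma supn_le_norm: "supn x \<le> norm x"
  unfolding supn_le_iff using component_le_norm_cart by blast

lemma norm_le_supn: "norm (x::real^'n) \<le> real CARD('n) * supn x"
proof -
  have "norm x \<le> (\<Sum>i\<in>UNIV. \<bar>x $ i\<bar>)" by (rule norm_le_l1_cart)
  also have "\<dots> \<le> (\<Sum>i\<in>(UNIV::'n set). supn x)" by (rule sum_mono) (rule supn_ge)
  finally show ?thesis by simp
qed

lemma supn_add: "supn (x + y) \<le> supn x + supn y"
  unfolding supn_le_iff using supn_ge[of x] supn_ge[of y] abs_triangle_ineq
  by (metis order_trans add_mono vector_add_component)

lemma supn_neg [simp]: "supn (- x) = supn x"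
  unfolding supn_def by simp

lemma supn_minus_commute: "supn (x - y) = supn (y - x)"
  using supn_neg[of "x - y"] by simp

lemma supn_scale: "supn (c *\<^sub>R x) = \<bar>c\<bar> * supn x"
proof (rule antisym)
  show "supn (c *\<^sub>R x) \<le> \<bar>c\<bar> * supn x"
    unfolding supn_le_iff by (simp add: abs_mult mult_left_mono supn_ge)
  have "supn x \<in> range (\<lambda>i. \<bar>x $ i\<bar>)" unfolding supn_def by (rule Max_in) auto
  then obtain i where i: "supn x = \<bar>x $ i\<bar>" by auto
  show "\<bar>c\<bar> * supn x \<le> supn (c *\<^sub>R x)"
    using supn_ge[of "c *\<^sub>R x" i] i by (simp add: abs_mult)
qed

lemma supn_zero [simp]: "supn 0 = 0"
  unfolding supn_def by simp

lemma supn_eq_0_iff: "supn x = 0 \<longleftrightarrow> x = 0"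
proof
  assume "supn x = 0" then show "x = 0"
    using supn_ge[of x] by (simp add: vec_eq_iff)
qed simp

lemma supn_pos: "x \<noteq> 0 \<Longrightarrow> 0 < supn x"
  using supn_eq_0_iff supn_nonneg by (metis less_eq_real_def)

lemma supn_sum: "finite A \<Longrightarrow> supn (\<Sum>j\<in>A. f j) \<le> (\<Sum>j\<in>A. supn (f j))"
  by (induction A rule: finite_induct) (auto intro: order_trans[OF supn_add])

lemma supn_unit_exists: "\<exists>x::real^'n. supn x = 1"
  by (rule exI[of _ 1]) (simp add: supn_def)

text \<open>The sup-operator norm bounds every matrix, and it is the best constant in
  \<open>supn (A x) \<le> \<parallel>A\<parallel> supn x\<close>.\<close>

lemma opnorm_bdd_above:
  fixes A :: "real^'n^'k"
  shows "bdd_above ((\<lambda>x. supn (A *v x)) ` {x. supn x = 1})"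
proof (rule bdd_aboveI2)
  fix x :: "real^'n" assume x: "x \<in> {x. supn x = 1}"
  have "supn (A *v x) \<le> (\<Sum>i\<in>UNIV. \<Sum>j\<in>UNIV. \<bar>A $ i $ j\<bar>) * supn x"
    unfolding supn_le_iff
  proof
    fix i
    have "\<bar>(A *v x) $ i\<bar> \<le> (\<Sum>j\<in>UNIV. \<bar>A $ i $ j\<bar> * supn x)"
      unfolding matrix_vector_mult_def
      by (auto intro!: order_trans[OF sum_abs] sum_mono simp: abs_mult mult_left_mono supn_ge)
    also have "\<dots> \<le> (\<Sum>i\<in>UNIV. \<Sum>j\<in>UNIV. \<bar>A $ i $ j\<bar>) * supn x"
      unfolding sum_distrib_right[symmetric]
      by (rule mult_right_mono[OF member_le_sum]) (auto simp: supn_nonneg)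
    finally show "\<bar>(A *v x) $ i\<bar> \<le> (\<Sum>i\<in>UNIV. \<Sum>j\<in>UNIV. \<bar>A $ i $ j\<bar>) * supn x" .
  qed
  with x show "supn (A *v x) \<le> (\<Sum>i\<in>UNIV. \<Sum>j\<in>UNIV. \<bar>A $ i $ j\<bar>)" by simp
qed

lemma supn_matrix_le: "supn (A *v x) \<le> opnorm_inf A * supn x"
proof (cases "x = 0")
  case True then show ?thesis by (simp add: supn_nonneg)
next
  case False
  then have s: "supn x > 0" by (rule supn_pos)
  define y where "y = (1 / supn x) *\<^sub>R x"
  have "supn y = 1" using s by (simp add: y_def supn_scale)
  then have "supn (A *v y) \<le> opnorm_inf A"
    unfolding opnorm_inf_def by (intro cSUP_upper opnorm_bdd_above) simp
  moreover have "A *v x = supn x *\<^sub>R (A *v y)" using s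
    by (simp add: y_def matrix_vector_mult_scaleR)
  ultimately show ?thesis using s by (simp add: supn_scale mult.commute)
qed

lemma opnorm_nonneg: "0 \<le> opnorm_inf (A::real^'n^'k)"
proof -
  obtain x :: "real^'n" where "supn x = 1" using supn_unit_exists by blast
  then show ?thesis using supn_matrix_le[of A x] supn_nonneg[of "A *v x"] by simp
qed

text \<open>Negated matrices obey the same bound; differences of functions use the weight \<open>-1\<close>.\<close>

lemma matrix_vector_mult_uminus: "(- A) *v x = - (A *v (x :: real^'n))"
  by (simp add: matrix_vector_mult_def vec_eq_iff sum_negf)

lemma supn_neg_matrix_le: "supn ((- A) *v x) \<le> opnorm_inf A * supn x"
  using supn_matrix_le[of A x] by (simp add: matrix_vector_mult_uminus)

text \<open>A \<open>k\<close>-linear map, represented as a function of a direction sequence that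
  only depends on its first \<open>k\<close> entries and is linear in each of them.\<close>

definition multilinear :: "nat \<Rightarrow> ((nat \<Rightarrow> real^'m) \<Rightarrow> real^'d) \<Rightarrow> bool" where
  "multilinear k M \<longleftrightarrow> (\<forall>xi xi'. (\<forall>i<k. xi i = xi' i) \<longrightarrow> M xi = M xi') \<and>
     (\<forall>i<k. \<forall>xi. linear (\<lambda>v. M (xi(i:=v))))"

lemma basis_expansion_scaleR: "(x::real^'n) = (\<Sum>l\<in>UNIV. (x $ l) *\<^sub>R axis l 1)"
  using basis_expansion[of x] by (simp add: scalar_mult_eq_scaleR)

text \<open>Multilinear maps in finite dimension are bounded on products of unit balls;
  expanding the last argument in the standard basis reduces \<open>k + 1\<close> to \<open>k\<close>.\<close>

lemma multilinear_bounded: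
  fixes M :: "(nat \<Rightarrow> real^'m) \<Rightarrow> real^'d"
  shows "multilinear k M \<Longrightarrow> \<exists>C. \<forall>xi. (\<forall>i<k. supn (xi i) \<le> 1) \<longrightarrow> supn (M xi) \<le> C"
proof (induction k arbitrary: M)
  case 0
  then have "M xi = M (\<lambda>_. 0)" for xi unfolding multilinear_def by blast
  then show ?case by (metis order_refl)
next
  case (Suc k)
  have dep: "\<And>xi xi'. (\<forall>i<Suc k. xi i = xi' i) \<Longrightarrow> M xi = M xi'"
    and lin: "\<And>i xi. i < Suc k \<Longrightarrow> linear (\<lambda>v. M (xi(i:=v)))"
    using Suc.prems unfolding multilinear_def by blast+
  define Ml where "Ml l = (\<lambda>xi. M (xi(k := axis l 1)))" for l :: 'm
  have "multilinear k (Ml l)" for l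
    unfolding multilinear_def
  proof (intro conjI allI impI)
    fix xi xi' :: "nat \<Rightarrow> real^'m" assume "\<forall>i<k. xi i = xi' i"
    then show "Ml l xi = Ml l xi'" unfolding Ml_def by (intro dep) auto
  next
    fix i and xi :: "nat \<Rightarrow> real^'m" assume i: "i < k"
    have "(\<lambda>v. Ml l (xi(i := v))) = (\<lambda>v. M ((xi(k := axis l 1))(i := v)))"
      unfolding Ml_def using i by (simp add: fun_upd_twist)
    then show "linear (\<lambda>v. Ml l (xi(i := v)))" using lin[of i] i by simp
  qed
  then have "\<forall>l. \<exists>C. \<forall>xi. (\<forall>i<k. supn (xi i) \<le> 1) \<longrightarrow> supn (Ml l xi) \<le> C"
    using Suc.IH by blast
  then obtain C where C: "\<And>l xi. (\<forall>i<k. supn (xi i) \<le> 1) \<Longrightarrow> supn (Ml l xi) \<le> C l"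
    by metis
  show ?case
  proof (intro exI allI impI)
    fix xi :: "nat \<Rightarrow> real^'m" assume xi: "\<forall>i<Suc k. supn (xi i) \<le> 1"
    have "M xi = M (xi(k := (\<Sum>l\<in>UNIV. (xi k $ l) *\<^sub>R axis l 1)))"
      by (simp only: basis_expansion_scaleR[of "xi k", symmetric] fun_upd_triv)
    also have "\<dots> = (\<Sum>l\<in>UNIV. (xi k $ l) *\<^sub>R Ml l xi)"
      unfolding Ml_def
      by (simp add: real_vector.linear_sum[OF lin[of k]] real_vector.linear_scale[OF lin[of k]])
    finally have "supn (M xi) \<le> (\<Sum>l\<in>UNIV. supn ((xi k $ l) *\<^sub>R Ml l xi))"
      using supn_sum[of UNIV "\<lambda>l. (xi k $ l) *\<^sub>R Ml l xi"] by simp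
    also have "\<dots> \<le> (\<Sum>l\<in>UNIV. 1 * \<bar>C l\<bar>)"
    proof (rule sum_mono)
      fix l
      have "\<bar>xi k $ l\<bar> \<le> 1" using supn_ge[of "xi k" l] xi by force
      moreover have "supn (Ml l xi) \<le> \<bar>C l\<bar>" using C[of xi l] xi by force
      ultimately show "supn ((xi k $ l) *\<^sub>R Ml l xi) \<le> 1 * \<bar>C l\<bar>"
        unfolding supn_scale by (intro mult_mono) (auto simp: supn_nonneg)
    qed
    finally show "supn (M xi) \<le> (\<Sum>l\<in>UNIV. \<bar>C l\<bar>)" by simp
  qed
qed

text \<open>Basic properties of the multilinear norm, a supremum over frames of unit vectors.\<close>

lemma unit_frames_nonempty: "{xi :: nat \<Rightarrow> real^'m. \<forall>i<k. supn (xi i) = 1} \<noteq> {}"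
  using supn_unit_exists[where 'n='m] by auto

lemma supn_le_mlnorm:
  fixes M :: "(nat \<Rightarrow> real^'m) \<Rightarrow> real^'d"
  assumes "multilinear k M" "\<forall>i<k. supn (xi i) = 1"
  shows "supn (M xi) \<le> mlnorm k M"
proof -
  obtain C where C: "\<And>xi. (\<forall>i<k. supn (xi i) \<le> 1) \<Longrightarrow> supn (M xi) \<le> C"
    using multilinear_bounded[OF assms(1)] by blast
  have "bdd_above ((\<lambda>xi. supn (M xi)) ` {xi. \<forall>i<k. supn (xi i) = 1})"
    by (rule bdd_aboveI2[where M=C]) (simp add: C)
  then show ?thesis
    unfolding mlnorm_def by (rule cSUP_upper[rotated]) (simp add: assms(2))
qed

lemma mlnorm_le:
  fixes M :: "(nat \<Rightarrow> real^'m) \<Rightarrow> real^'d"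
  assumes "\<And>xi. \<forall>i<k. supn (xi i) = 1 \<Longrightarrow> supn (M xi) \<le> C"
  shows "mlnorm k M \<le> C"
  unfolding mlnorm_def using assms unit_frames_nonempty by (intro cSUP_least) auto

lemma mlnorm_nonneg:
  fixes M :: "(nat \<Rightarrow> real^'m) \<Rightarrow> real^'d"
  assumes "multilinear k M"
  shows "0 \<le> mlnorm k M"
proof -
  obtain xi :: "nat \<Rightarrow> real^'m" where "\<forall>i<k. supn (xi i) = 1"
    using unit_frames_nonempty by blast
  then show ?thesis using supn_le_mlnorm[OF assms] supn_nonneg by (meson order_trans)
qed

text \<open>The defining estimate of the multilinear norm:
  \<open>supn (M \<xi>) \<le> \<parallel>M\<parallel> \<Prod>\<^sub>i supn \<xi>\<^sub>i\<close>; arguments \<open>0, \<dots>, n-1\<close> are normalised one at a time.\<close>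

lemma supn_le_mlnorm_prod_aux:
  fixes M :: "(nat \<Rightarrow> real^'m) \<Rightarrow> real^'d"
  assumes ml: "multilinear k M"
  shows "n \<le> k \<Longrightarrow> (\<forall>i<k. n \<le> i \<longrightarrow> supn (xi i) = 1) \<Longrightarrow>
    supn (M xi) \<le> mlnorm k M * (\<Prod>i<n. supn (xi i))"
proof (induction n arbitrary: xi)
  case 0 then show ?case using supn_le_mlnorm[OF ml] by simp
next
  case (Suc n)
  have lin: "linear (\<lambda>v. M (xi(n:=v)))" using ml Suc.prems unfolding multilinear_def by simp
  show ?case
  proof (cases "xi n = 0")
    case True
    then have "M xi = M (xi(n := 0))" by (simp add: fun_upd_idem)
    also have "\<dots> = 0" using real_vector.linear_0[OF lin] by simp
    finally show ?thesis
      using mlnorm_nonneg[OF ml] by (simp add: prod_nonneg supn_nonneg)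
  next
    case False
    define s where "s = supn (xi n)"
    have s: "s > 0" unfolding s_def by (rule supn_pos[OF False])
    define xi' where "xi' = xi(n := (1/s) *\<^sub>R xi n)"
    have "\<forall>i<k. Suc n \<le> i \<longrightarrow> supn (xi i) = 1" using Suc.prems by auto
    moreover have "supn (xi' n) = 1" using s by (simp add: xi'_def supn_scale s_def)
    ultimately have unit: "\<forall>i<k. n \<le> i \<longrightarrow> supn (xi' i) = 1"
      by (auto simp: xi'_def le_eq_less_or_eq Suc_le_eq)
    have "M xi = M (xi'(n := s *\<^sub>R xi' n))" using s by (simp add: xi'_def)
    also have "\<dots> = s *\<^sub>R M xi'"
      using real_vector.linear_scale[OF lin] by (simp add: xi'_def)
    finally have "supn (M xi) = s * supn (M xi')" using s by (simp add: supn_scale)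
    also have "\<dots> \<le> s * (mlnorm k M * (\<Prod>i<n. supn (xi' i)))"
      using Suc.IH[OF _ unit] Suc.prems s by simp
    also have "(\<Prod>i<n. supn (xi' i)) = (\<Prod>i<n. supn (xi i))" by (simp add: xi'_def)
    finally show ?thesis by (simp add: s_def mult_ac)
  qed
qed

lemma supn_le_mlnorm_prod:
  fixes M :: "(nat \<Rightarrow> real^'m) \<Rightarrow> real^'d"
  assumes "multilinear k M"
  shows "supn (M xi) \<le> mlnorm k M * (\<Prod>i<k. supn (xi i))"
  using supn_le_mlnorm_prod_aux[OF assms, of k xi] by simp

lemma supn_le_mlnorm_pow:
  fixes M :: "(nat \<Rightarrow> real^'m) \<Rightarrow> real^'d"
  assumes "multilinear k M" "\<forall>i<k. supn (xi i) \<le> a"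
  shows "supn (M xi) \<le> mlnorm k M * a ^ k"
proof -
  have "(\<Prod>i<k. supn (xi i)) \<le> (\<Prod>i<k. a)"
    using assms(2) by (intro prod_mono) (simp add: supn_nonneg)
  then have "mlnorm k M * (\<Prod>i<k. supn (xi i)) \<le> mlnorm k M * a ^ k"
    using mlnorm_nonneg[OF assms(1)] by (simp add: mult_left_mono)
  then show ?thesis using supn_le_mlnorm_prod[OF assms(1), of xi] by linarith
qed

lemma multilinear_diff:
  fixes M M' :: "(nat \<Rightarrow> real^'m) \<Rightarrow> real^'d"
  assumes "multilinear k M" "multilinear k M'"
  shows "multilinear k (\<lambda>xi. M xi - M' xi)"
  unfolding multilinear_def
proof (intro conjI allI impI)
  fix xi xi' :: "nat \<Rightarrow> real^'m" assume "\<forall>i<k. xi i = xi' i"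
  then have "M xi = M xi'" "M' xi = M' xi'" using assms unfolding multilinear_def by blast+
  then show "M xi - M' xi = M xi' - M' xi'" by simp
next
  fix i and xi :: "nat \<Rightarrow> real^'m" assume "i < k"
  then have "linear (\<lambda>v. M (xi(i := v)))" "linear (\<lambda>v. M' (xi(i := v)))"
    using assms unfolding multilinear_def by blast+
  then show "linear (\<lambda>v. M (xi(i := v)) - M' (xi(i := v)))" by (rule linear_compose_sub)
qed

text \<open>The multilinear norm is 1-Lipschitz with respect to itself.\<close>

lemma mlnorm_diff_le:
  fixes M M' :: "(nat \<Rightarrow> real^'m) \<Rightarrow> real^'d"
  assumes "multilinear k M" "multilinear k M'"
  shows "\<bar>mlnorm k M - mlnorm k M'\<bar> \<le> mlnorm k (\<lambda>xi. M xi - M' xi)"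
proof -
  have tri: "mlnorm k N \<le> mlnorm k N' + mlnorm k (\<lambda>xi. M xi - M' xi)"
    if "multilinear k N" "multilinear k N'" "\<And>xi. supn (N xi - N' xi) = supn (M xi - M' xi)"
    for N N' :: "(nat \<Rightarrow> real^'m) \<Rightarrow> real^'d"
  proof (rule mlnorm_le)
    fix xi :: "nat \<Rightarrow> real^'m" assume xi: "\<forall>i<k. supn (xi i) = 1"
    have "supn (N xi) \<le> supn (N' xi) + supn (N xi - N' xi)"
      using supn_add[of "N' xi" "N xi - N' xi"] by simp
    then show "supn (N xi) \<le> mlnorm k N' + mlnorm k (\<lambda>xi. M xi - M' xi)"
      using supn_le_mlnorm[OF that(2) xi] supn_le_mlnorm[OF multilinear_diff[OF assms] xi] that(3)[of xi]
      by linarith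
  qed
  have "mlnorm k M \<le> mlnorm k M' + mlnorm k (\<lambda>xi. M xi - M' xi)"
    by (rule tri[OF assms]) simp
  moreover have "mlnorm k M' \<le> mlnorm k M + mlnorm k (\<lambda>xi. M xi - M' xi)"
    by (rule tri[OF assms(2,1)]) (rule supn_minus_commute)
  ultimately show ?thesis by linarith
qed

text \<open>\<open>D\<close> is the box \<open>[-\<rho>, \<rho>]\<^sup>m\<close>: compact, convex, and of diameter comparable to \<open>\<rho>\<close>.\<close>

lemma Dset_cbox: "Dset \<rho> = cbox (- (\<chi> i. \<rho>)) ((\<chi> i. \<rho>) :: real^'m)"
  unfolding Dset_def cbox_def supn_le_iff
  by (auto simp: Basis_vec_def cart_eq_inner_axis[symmetric] abs_le_iff) (metis minus_le_iff)+

lemma zero_in_Dset: "\<rho> \<ge> 0 \<Longrightarrow> 0 \<in> Dset \<rho>"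
  unfolding Dset_def by simp

lemma compact_Dset: "compact (Dset \<rho> :: (real^'m) set)"
  unfolding Dset_cbox by (rule compact_cbox)

lemma convex_Dset: "convex (Dset \<rho> :: (real^'m) set)"
  unfolding Dset_cbox by (rule convex_box)

lemma norm_le_on_Dset: "x \<in> Dset \<rho> \<Longrightarrow> norm (x::real^'m) \<le> real CARD('m) * \<rho>"
  using norm_le_supn[of x] unfolding Dset_def
  by (smt (verit) mem_Collect_eq mult_left_mono of_nat_0_le_iff)

text \<open>Derivatives within \<open>D\<close> are unique since \<open>D\<close> is a nondegenerate box; this is
  what makes the iterated derivative \<open>dd\<close> computable by the usual rules.\<close>

lemma frechet_derivative_Dset:
  fixes f :: "real^'m \<Rightarrow> 'b::real_normed_vector"
  assumes "\<rho> > 0" "x \<in> Dset \<rho>" "(f has_derivative f') (at x within Dset \<rho>)"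
  shows "frechet_derivative f (at x within Dset \<rho>) = f'"
  unfolding Dset_cbox
proof (rule frechet_derivative_within_cbox)
  show "(- (\<chi> i. \<rho>)) \<bullet> i < (\<chi> i. \<rho>) \<bullet> i" if "i \<in> Basis" for i :: "real^'m"
    using assms(1) that by (auto simp: Basis_vec_def inner_axis)
qed (use assms[unfolded Dset_cbox] in auto)

text \<open>Derivatives within \<open>S\<close> depend only on the values on \<open>S\<close>.\<close>

lemma has_derivative_within_cong:
  assumes "x \<in> S" "\<And>y. y \<in> S \<Longrightarrow> f y = g y"
  shows "(f has_derivative f') (at x within S) \<longleftrightarrow> (g has_derivative f') (at x within S)"
  using assms has_derivative_transform_within[of f f' x S 1 g]
    has_derivative_transform_within[of g f' x S 1 f] by auto

lemma frechet_derivative_within_cong: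
  assumes "x \<in> S" "\<And>y. y \<in> S \<Longrightarrow> f y = g y"
  shows "frechet_derivative f (at x within S) = frechet_derivative g (at x within S)"
  unfolding frechet_derivative_def using has_derivative_within_cong[OF assms] by simp

lemma differentiable_within_cong:
  assumes "f differentiable (at x within S)" "x \<in> S" "\<And>y. y \<in> S \<Longrightarrow> f y = g y"
  shows "g differentiable (at x within S)"
proof -
  obtain D where "(f has_derivative D) (at x within S)"
    using assms(1) unfolding differentiable_def by blast
  then have "(g has_derivative D) (at x within S)" using has_derivative_within_cong[OF assms(2,3)] by simp
  then show ?thesis unfolding differentiable_def by blast
qed

text \<open>\<open>dd\<close> only sees the values on \<open>S\<close> and the first \<open>k\<close> directions.\<close>

lemma dd_cong:
  assumes "\<And>y. y \<in> S \<Longrightarrow> f y = g y" "x \<in> S"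
  shows "dd S k f xi x = dd S k g xi x"
  using assms(2)
proof (induction k arbitrary: x)
  case 0 then show ?case using assms(1) by simp
next
  case (Suc k)
  then show ?case by (simp add: frechet_derivative_within_cong[OF Suc.prems Suc.IH])
qed

lemma dd_directions_cong:
  "(\<And>i. i < k \<Longrightarrow> xi i = xi' i) \<Longrightarrow> dd S k f xi = dd S k f xi'"
proof (induction k)
  case (Suc k)
  then have e: "dd S k f xi = dd S k f xi'" by simp
  show ?case by (rule ext) (simp only: dd.simps e Suc.prems lessI)
qed (simp add: fun_eq_iff)

lemma dd_Suc_upd: "dd S (Suc k) f (xi(k := h)) x = frechet_derivative (dd S k f xi) (at x within S) h"
  using dd_directions_cong[of k "xi(k := h)" xi S f] by simp

text \<open>\<open>f\<close> has iterated derivatives \<open>dd S j f\<close> that are differentiable for \<open>j < k\<close>.\<close>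

definition smooth :: "(real^'m) set \<Rightarrow> nat \<Rightarrow> (real^'m \<Rightarrow> real^'d) \<Rightarrow> bool" where
  "smooth S k f \<longleftrightarrow> (\<forall>j<k. \<forall>xi. \<forall>x\<in>S. (\<lambda>y. dd S j f xi y) differentiable (at x within S))"

lemma smoothD: "smooth S k f \<Longrightarrow> j < k \<Longrightarrow> x \<in> S \<Longrightarrow> (\<lambda>y. dd S j f xi y) differentiable (at x within S)"
  unfolding smooth_def by blast

lemma smooth_has_derivative:
  "smooth S k f \<Longrightarrow> j < k \<Longrightarrow> x \<in> S \<Longrightarrow>
    (dd S j f xi has_derivative (\<lambda>h. dd S (Suc j) f (xi(j := h)) x)) (at x within S)"
  unfolding dd_Suc_upd by (metis frechet_derivative_works smoothD)

context fixes \<rho> :: real assumes rho: "\<rho> > 0"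
begin

text \<open>Differentiation rules within \<open>D\<close>, stated for the (unique) Frechet derivative.\<close>

lemma frechet_derivative_add_Dset:
  fixes f g :: "real^'m \<Rightarrow> 'b::real_normed_vector"
  assumes "x \<in> Dset \<rho>" "f differentiable (at x within Dset \<rho>)" "g differentiable (at x within Dset \<rho>)"
  shows "frechet_derivative (\<lambda>y. f y + g y) (at x within Dset \<rho>)
     = (\<lambda>h. frechet_derivative f (at x within Dset \<rho>) h + frechet_derivative g (at x within Dset \<rho>) h)"
  by (rule frechet_derivative_Dset[OF rho assms(1)])
    (intro has_derivative_add frechet_derivative_works[THEN iffD1] assms(2,3))

lemma frechet_derivative_linear_Dset:
  fixes f :: "real^'m \<Rightarrow> 'b::real_normed_vector"
  assumes "x \<in> Dset \<rho>" "f differentiable (at x within Dset \<rho>)" "bounded_linear L"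
  shows "frechet_derivative (\<lambda>y. L (f y)) (at x within Dset \<rho>)
     = (\<lambda>h. L (frechet_derivative f (at x within Dset \<rho>) h))"
  using frechet_derivative_Dset[OF rho assms(1) bounded_linear.has_derivative[OF assms(3)
      frechet_derivative_works[THEN iffD1, OF assms(2)]]]
  by (simp add: o_def)

text \<open>Chain rule for precomposition with a linear self-map of \<open>D\<close>.\<close>

lemma frechet_derivative_comp_Dset:
  fixes f :: "real^'m \<Rightarrow> 'b::real_normed_vector"
  assumes "x \<in> Dset \<rho>" "linear T" "T ` Dset \<rho> \<subseteq> Dset \<rho>"
    "f differentiable (at (T x) within Dset \<rho>)"
  shows "frechet_derivative (\<lambda>y. f (T y)) (at x within Dset \<rho>)
     = (\<lambda>h. frechet_derivative f (at (T x) within Dset \<rho>) (T h))"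
    and "(\<lambda>y. f (T y)) differentiable (at x within Dset \<rho>)"
proof -
  have T: "(T has_derivative T) (at x within Dset \<rho>)"
    using assms(2) by (simp add: bounded_linear_imp_has_derivative linear_conv_bounded_linear)
  have F: "(f has_derivative frechet_derivative f (at (T x) within Dset \<rho>)) (at (T x) within T ` Dset \<rho>)"
    using frechet_derivative_works[THEN iffD1, OF assms(4)] assms(3) by (rule has_derivative_subset)
  have "((f \<circ> T) has_derivative (frechet_derivative f (at (T x) within Dset \<rho>) \<circ> T)) (at x within Dset \<rho>)"
    by (rule diff_chain_within[OF T F])
  then show "frechet_derivative (\<lambda>y. f (T y)) (at x within Dset \<rho>)
     = (\<lambda>h. frechet_derivative f (at (T x) within Dset \<rho>) (T h))"
    and "(\<lambda>y. f (T y)) differentiable (at x within Dset \<rho>)"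
    using frechet_derivative_Dset[OF rho assms(1)] unfolding differentiable_def by (auto simp: o_def)
qed

text \<open>The zero function, and functions agreeing with a smooth function on \<open>D\<close>.\<close>

lemma dd_zero: "x \<in> Dset \<rho> \<Longrightarrow> dd (Dset \<rho>) k (\<lambda>y. 0 :: real^'d) xi x = 0"
proof (induction k arbitrary: x)
  case 0 then show ?case by simp
next
  case (Suc k)
  have "frechet_derivative (\<lambda>y. dd (Dset \<rho>) k (\<lambda>y. 0 :: real^'d) xi y) (at x within Dset \<rho>)
      = frechet_derivative (\<lambda>y. 0) (at x within Dset \<rho>)"
    using Suc by (intro frechet_derivative_within_cong) auto
  also have "\<dots> = (\<lambda>h. 0)" by (rule frechet_derivative_Dset[OF rho Suc.prems]) simp
  finally show ?case by simp
qed

lemma smooth_zero: "smooth (Dset \<rho>) k (\<lambda>y. 0 :: real^'d)"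
  unfolding smooth_def
  by (auto intro: differentiable_within_cong[OF differentiable_const[of 0]] simp: dd_zero)

lemma smooth_cong:
  fixes f g :: "real^'m \<Rightarrow> real^'d"
  assumes "smooth (Dset \<rho>) k f" "\<And>y. y \<in> Dset \<rho> \<Longrightarrow> f y = g y"
  shows "smooth (Dset \<rho>) k g"
  unfolding smooth_def
proof (intro allI impI ballI)
  fix j xi and x :: "real^'m" assume j: "j < k" and x: "x \<in> Dset \<rho>"
  show "(\<lambda>y. dd (Dset \<rho>) j g xi y) differentiable (at x within Dset \<rho>)"
    by (rule differentiable_within_cong[OF smoothD[OF assms(1) j x] x]) (rule dd_cong[OF assms(2)])
qed

text \<open>The rules for \<open>f + g\<close>, \<open>L \<circ> f\<close> (\<open>L\<close> linear) and \<open>f \<circ> T\<close> (\<open>T\<close> a linear self-map of \<open>D\<close>),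
  each proved by induction on the order of the derivative.\<close>

lemma smooth_add:
  fixes f g :: "real^'m \<Rightarrow> real^'d"
  assumes f: "smooth (Dset \<rho>) k f" and g: "smooth (Dset \<rho>) k g"
  shows "smooth (Dset \<rho>) k (\<lambda>y. f y + g y)"
    and "j \<le> k \<Longrightarrow> x \<in> Dset \<rho> \<Longrightarrow>
      dd (Dset \<rho>) j (\<lambda>y. f y + g y) xi x = dd (Dset \<rho>) j f xi x + dd (Dset \<rho>) j g xi x"
proof -
  show dd_eq: "dd (Dset \<rho>) j (\<lambda>y. f y + g y) xi x = dd (Dset \<rho>) j f xi x + dd (Dset \<rho>) j g xi x"
    if "j \<le> k" "x \<in> Dset \<rho>" for j x xi
    using that
  proof (induction j arbitrary: x)
    case (Suc j)
    have "frechet_derivative (\<lambda>y. dd (Dset \<rho>) j (\<lambda>y. f y + g y) xi y) (at x within Dset \<rho>)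
        = frechet_derivative (\<lambda>y. dd (Dset \<rho>) j f xi y + dd (Dset \<rho>) j g xi y) (at x within Dset \<rho>)"
      using Suc by (intro frechet_derivative_within_cong) auto
    also have "\<dots> = (\<lambda>h. frechet_derivative (\<lambda>y. dd (Dset \<rho>) j f xi y) (at x within Dset \<rho>) h
        + frechet_derivative (\<lambda>y. dd (Dset \<rho>) j g xi y) (at x within Dset \<rho>) h)"
      using Suc.prems by (intro frechet_derivative_add_Dset smoothD[OF f] smoothD[OF g]) auto
    finally show ?case by simp
  qed simp
  show "smooth (Dset \<rho>) k (\<lambda>y. f y + g y)"
    unfolding smooth_def
  proof (intro allI impI ballI)
    fix j xi and x :: "real^'m" assume j: "j < k" and x: "x \<in> Dset \<rho>"
    have "(\<lambda>y. dd (Dset \<rho>) j f xi y + dd (Dset \<rho>) j g xi y) differentiable (at x within Dset \<rho>)"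
      by (intro differentiable_add smoothD[OF f] smoothD[OF g] j x)
    then show "(\<lambda>y. dd (Dset \<rho>) j (\<lambda>y. f y + g y) xi y) differentiable (at x within Dset \<rho>)"
      by (rule differentiable_within_cong[OF _ x]) (simp add: dd_eq j less_imp_le)
  qed
qed

lemma smooth_linear:
  fixes f :: "real^'m \<Rightarrow> real^'d" and L :: "real^'d \<Rightarrow> real^'e"
  assumes f: "smooth (Dset \<rho>) k f" and L: "bounded_linear L"
  shows "smooth (Dset \<rho>) k (\<lambda>y. L (f y))"
    and "j \<le> k \<Longrightarrow> x \<in> Dset \<rho> \<Longrightarrow> dd (Dset \<rho>) j (\<lambda>y. L (f y)) xi x = L (dd (Dset \<rho>) j f xi x)"
proof -
  show dd_eq: "dd (Dset \<rho>) j (\<lambda>y. L (f y)) xi x = L (dd (Dset \<rho>) j f xi x)"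
    if "j \<le> k" "x \<in> Dset \<rho>" for j x xi
    using that
  proof (induction j arbitrary: x)
    case (Suc j)
    have "frechet_derivative (\<lambda>y. dd (Dset \<rho>) j (\<lambda>y. L (f y)) xi y) (at x within Dset \<rho>)
        = frechet_derivative (\<lambda>y. L (dd (Dset \<rho>) j f xi y)) (at x within Dset \<rho>)"
      using Suc by (intro frechet_derivative_within_cong) auto
    also have "\<dots> = (\<lambda>h. L (frechet_derivative (\<lambda>y. dd (Dset \<rho>) j f xi y) (at x within Dset \<rho>) h))"
      using Suc.prems by (intro frechet_derivative_linear_Dset[OF _ _ L] smoothD[OF f]) auto
    finally show ?case by simp
  qed simp
  show "smooth (Dset \<rho>) k (\<lambda>y. L (f y))"
    unfolding smooth_def
  proof (intro allI impI ballI)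
    fix j xi and x :: "real^'m" assume j: "j < k" and x: "x \<in> Dset \<rho>"
    have "(\<lambda>y. L (dd (Dset \<rho>) j f xi y)) differentiable (at x within Dset \<rho>)"
      using smoothD[OF f j x] L bounded_linear.has_derivative unfolding differentiable_def by blast
    then show "(\<lambda>y. dd (Dset \<rho>) j (\<lambda>y. L (f y)) xi y) differentiable (at x within Dset \<rho>)"
      by (rule differentiable_within_cong[OF _ x]) (simp add: dd_eq j less_imp_le)
  qed
qed

lemma smooth_comp:
  fixes f :: "real^'m \<Rightarrow> real^'d" and T :: "real^'m \<Rightarrow> real^'m"
  assumes f: "smooth (Dset \<rho>) k f" and T: "linear T" "T ` Dset \<rho> \<subseteq> Dset \<rho>"
  shows "smooth (Dset \<rho>) k (\<lambda>y. f (T y))"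
    and "j \<le> k \<Longrightarrow> x \<in> Dset \<rho> \<Longrightarrow>
      dd (Dset \<rho>) j (\<lambda>y. f (T y)) xi x = dd (Dset \<rho>) j f (\<lambda>i. T (xi i)) (T x)"
proof -
  show dd_eq: "dd (Dset \<rho>) j (\<lambda>y. f (T y)) xi x = dd (Dset \<rho>) j f (\<lambda>i. T (xi i)) (T x)"
    if "j \<le> k" "x \<in> Dset \<rho>" for j x xi
    using that
  proof (induction j arbitrary: x)
    case (Suc j)
    have Tx: "T x \<in> Dset \<rho>" using T(2) Suc.prems by auto
    have "frechet_derivative (\<lambda>y. dd (Dset \<rho>) j (\<lambda>y. f (T y)) xi y) (at x within Dset \<rho>)
        = frechet_derivative (\<lambda>y. dd (Dset \<rho>) j f (\<lambda>i. T (xi i)) (T y)) (at x within Dset \<rho>)"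
      using Suc by (intro frechet_derivative_within_cong) auto
    also have "\<dots> = (\<lambda>h. frechet_derivative (\<lambda>y. dd (Dset \<rho>) j f (\<lambda>i. T (xi i)) y)
        (at (T x) within Dset \<rho>) (T h))"
      using Suc.prems Tx by (intro frechet_derivative_comp_Dset(1)[OF _ T] smoothD[OF f]) auto
    finally show ?case by simp
  qed simp
  show "smooth (Dset \<rho>) k (\<lambda>y. f (T y))"
    unfolding smooth_def
  proof (intro allI impI ballI)
    fix j xi and x :: "real^'m" assume j: "j < k" and x: "x \<in> Dset \<rho>"
    have "(\<lambda>y. dd (Dset \<rho>) j f (\<lambda>i. T (xi i)) (T y)) differentiable (at x within Dset \<rho>)"
      using T x by (intro frechet_derivative_comp_Dset(2)[OF x T] smoothD[OF f] j) auto
    then show "(\<lambda>y. dd (Dset \<rho>) j (\<lambda>y. f (T y)) xi y) differentiable (at x within Dset \<rho>)"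
      by (rule differentiable_within_cong[OF _ x]) (simp add: dd_eq j less_imp_le)
  qed
qed

lemma smooth_sum:
  fixes F :: "'j \<Rightarrow> real^'m \<Rightarrow> real^'d"
  assumes "finite J" "\<And>j. j \<in> J \<Longrightarrow> smooth (Dset \<rho>) k (F j)"
  shows "smooth (Dset \<rho>) k (\<lambda>y. \<Sum>j\<in>J. F j y) \<and>
    (\<forall>i\<le>k. \<forall>x\<in>Dset \<rho>. \<forall>xi.
       dd (Dset \<rho>) i (\<lambda>y. \<Sum>j\<in>J. F j y) xi x = (\<Sum>j\<in>J. dd (Dset \<rho>) i (F j) xi x))"
  using assms
proof (induction J rule: finite_induct)
  case empty then show ?case by (simp add: smooth_zero dd_zero)
next
  case (insert a J)
  then have s: "smooth (Dset \<rho>) k (\<lambda>y. \<Sum>j\<in>J. F j y)" and a: "smooth (Dset \<rho>) k (F a)" by auto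
  show ?case using insert by (simp add: smooth_add[OF a s])
qed

text \<open>For a smooth function the \<open>j\<close>-th derivative at a point is a \<open>j\<close>-linear map.\<close>

lemma dd_linear_in_direction:
  assumes f: "smooth (Dset \<rho>) k f"
  shows "j \<le> k \<Longrightarrow> x \<in> Dset \<rho> \<Longrightarrow> i < j \<Longrightarrow> linear (\<lambda>v. dd (Dset \<rho>) j f (xi(i:=v)) x)"
proof (induction j arbitrary: x xi i)
  case 0 then show ?case by simp
next
  case (Suc j)
  have jk: "j < k" and x: "x \<in> Dset \<rho>" using Suc.prems by auto
  show ?case
  proof (cases "i = j")
    case True
    have "(\<lambda>v. dd (Dset \<rho>) (Suc j) f (xi(j:=v)) x) = frechet_derivative (dd (Dset \<rho>) j f xi) (at x within Dset \<rho>)"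
      by (rule ext) (rule dd_Suc_upd)
    moreover have "linear (frechet_derivative (dd (Dset \<rho>) j f xi) (at x within Dset \<rho>))"
      by (rule bounded_linear.linear[OF has_derivative_bounded_linear])
        (rule frechet_derivative_works[THEN iffD1, OF smoothD[OF f jk x]])
    ultimately show ?thesis using True by (simp only:)
  next
    case False
    then have ij: "i < j" using Suc.prems by simp
    have lin: "\<And>y xi. y \<in> Dset \<rho> \<Longrightarrow> linear (\<lambda>v. dd (Dset \<rho>) j f (xi(i:=v)) y)"
      by (rule Suc.IH) (use jk ij in auto)
    define FD where "FD v = frechet_derivative (dd (Dset \<rho>) j f (xi(i:=v))) (at x within Dset \<rho>)" for v
    have add: "FD (a + b) = (\<lambda>h. FD a h + FD b h)" for a b
    proof -
      have "FD (a + b) = frechet_derivative (\<lambda>y. dd (Dset \<rho>) j f (xi(i:=a)) y + dd (Dset \<rho>) j f (xi(i:=b)) y)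
          (at x within Dset \<rho>)"
        unfolding FD_def using x by (intro frechet_derivative_within_cong) (auto simp: linear_add[OF lin])
      then show ?thesis unfolding FD_def
        by (simp add: frechet_derivative_add_Dset[OF x] smoothD[OF f jk x])
    qed
    have scale: "FD (c *\<^sub>R a) = (\<lambda>h. c *\<^sub>R FD a h)" for c a
    proof -
      have "FD (c *\<^sub>R a) = frechet_derivative (\<lambda>y. c *\<^sub>R dd (Dset \<rho>) j f (xi(i:=a)) y) (at x within Dset \<rho>)"
        unfolding FD_def using x by (intro frechet_derivative_within_cong) (auto simp: linear_scale[OF lin])
      then show ?thesis unfolding FD_def
        by (simp add: frechet_derivative_linear_Dset[OF x] smoothD[OF f jk x] bounded_linear_scaleR_right)
    qed
    have "(\<lambda>v. dd (Dset \<rho>) (Suc j) f (xi(i:=v)) x) = (\<lambda>v. FD v (xi j))"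
      using ij by (simp add: FD_def)
    moreover have "linear (\<lambda>v. FD v (xi j))"
      by (rule linearI) (simp_all add: add scale)
    ultimately show ?thesis by (simp only:)
  qed
qed

lemma dd_multilinear:
  assumes "smooth (Dset \<rho>) k f" "j \<le> k" "x \<in> Dset \<rho>"
  shows "multilinear j (\<lambda>xi. dd (Dset \<rho>) j f xi x)"
  unfolding multilinear_def
  using dd_directions_cong dd_linear_in_direction[OF assms(1,2,3)] by metis

end

text \<open>Comparison test: multilinear maps whose values on unit frames are bounded by
  \<open>b y \<rightarrow> 0\<close> have norms tending to \<open>0\<close>.\<close>

lemma mlnorm_tendsto_zero:
  fixes M :: "'a::topological_space \<Rightarrow> (nat \<Rightarrow> real^'m) \<Rightarrow> real^'d"
  assumes "\<And>y. y \<in> S \<Longrightarrow> multilinear k (M y)"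
    and "\<And>y xi. y \<in> S \<Longrightarrow> \<forall>i<k. supn (xi i) = 1 \<Longrightarrow> supn (M y xi) \<le> b y"
    and "(b \<longlongrightarrow> 0) (at x within S)"
  shows "((\<lambda>y. mlnorm k (M y)) \<longlongrightarrow> 0) (at x within S)"
proof (rule Lim_null_comparison[OF _ assms(3)])
  have "norm (mlnorm k (M y)) \<le> b y" if "y \<in> S" for y
    using mlnorm_nonneg[OF assms(1)[OF that]] mlnorm_le[OF assms(2)[OF that]] by simp
  then show "\<forall>\<^sub>F y in at x within S. norm (mlnorm k (M y)) \<le> b y"
    unfolding eventually_at_filter by (intro always_eventually) auto
qed

context fixes \<rho> :: real assumes rho: "\<rho> > 0"
begin

text \<open>Membership in \<open>H\<^sub>r\<close>, unfolded into its four components.\<close>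

lemma Hr_smooth: "P \<in> Hr \<rho> r \<Longrightarrow> smooth (Dset \<rho>) r P"
  unfolding Hr_def Cr_on_def smooth_def by blast

lemma Hr_multilinear:
  "P \<in> Hr \<rho> r \<Longrightarrow> k \<le> r \<Longrightarrow> x \<in> Dset \<rho> \<Longrightarrow> multilinear k (\<lambda>xi. dd (Dset \<rho>) k P xi x)"
  by (rule dd_multilinear[OF rho Hr_smooth])

lemma Hr_continuous:
  "P \<in> Hr \<rho> r \<Longrightarrow> x \<in> Dset \<rho> \<Longrightarrow>
   ((\<lambda>y. mlnorm r (\<lambda>xi. dd (Dset \<rho>) r P xi y - dd (Dset \<rho>) r P xi x)) \<longlongrightarrow> 0) (at x within Dset \<rho>)"
  unfolding Hr_def Cr_on_def by blast

lemma Hr_outside: "P \<in> Hr \<rho> r \<Longrightarrow> x \<notin> Dset \<rho> \<Longrightarrow> P x = 0"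
  unfolding Hr_def by blast

lemma Hr_dd_at_0: "P \<in> Hr \<rho> r \<Longrightarrow> i < r \<Longrightarrow> dd (Dset \<rho>) i P xi 0 = 0"
  unfolding Hr_def by blast

lemma HrI:
  assumes "smooth (Dset \<rho>) r P" "\<And>x. x \<notin> Dset \<rho> \<Longrightarrow> P x = 0"
    and "\<And>i xi. i < r \<Longrightarrow> dd (Dset \<rho>) i P xi 0 = 0"
    and "\<And>x. x \<in> Dset \<rho> \<Longrightarrow>
      ((\<lambda>y. mlnorm r (\<lambda>xi. dd (Dset \<rho>) r P xi y - dd (Dset \<rho>) r P xi x)) \<longlongrightarrow> 0) (at x within Dset \<rho>)"
  shows "P \<in> Hr \<rho> r"
  using assms unfolding Hr_def Cr_on_def smooth_def by blast

text \<open>The norm of \<open>H\<^sub>r\<close> is a finite supremum: \<open>x \<mapsto> \<parallel>D\<^sup>rP(x)\<parallel>\<close> is continuous on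
  the compact set \<open>D\<close>.\<close>

lemma Hnorm_bdd_above:
  fixes P :: "real^'m \<Rightarrow> real^'d"
  assumes P: "P \<in> Hr \<rho> r"
  shows "bdd_above ((\<lambda>x. mlnorm r (\<lambda>xi. dd (Dset \<rho>) r P xi x)) ` Dset \<rho>)"
proof -
  define h where "h x = mlnorm r (\<lambda>xi. dd (Dset \<rho>) r P xi x)" for x
  have "continuous_on (Dset \<rho>) h"
    unfolding continuous_on_def
  proof
    fix x :: "real^'m" assume x: "x \<in> Dset \<rho>"
    have "((\<lambda>y. h y - h x) \<longlongrightarrow> 0) (at x within Dset \<rho>)"
    proof (rule Lim_null_comparison[OF _ Hr_continuous[OF P x]])
      have "norm (h y - h x) \<le> mlnorm r (\<lambda>xi. dd (Dset \<rho>) r P xi y - dd (Dset \<rho>) r P xi x)"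
        if "y \<in> Dset \<rho>" for y :: "real^'m"
        unfolding h_def real_norm_def
        by (rule mlnorm_diff_le[OF Hr_multilinear[OF P _ that] Hr_multilinear[OF P _ x]]) simp_all
      then show "\<forall>\<^sub>F y in at x within Dset \<rho>.
          norm (h y - h x) \<le> mlnorm r (\<lambda>xi. dd (Dset \<rho>) r P xi y - dd (Dset \<rho>) r P xi x)"
        unfolding eventually_at_filter by (intro always_eventually) auto
    qed
    then show "(h \<longlongrightarrow> h x) (at x within Dset \<rho>)" by (simp add: Lim_null[symmetric])
  qed
  then have "compact (h ` Dset \<rho>)" by (rule compact_continuous_image[OF _ compact_Dset])
  then show ?thesis unfolding h_def by (intro bounded_imp_bdd_above compact_imp_bounded)
qed

text \<open>\<open>\<parallel>P\<parallel>\<close> bounds \<open>D\<^sup>rP\<close> at every point of \<open>D\<close>, and pointwise bounds bound \<open>\<parallel>P\<parallel>\<close>.\<close>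

lemma supn_le_Hnorm_pow:
  fixes P :: "real^'m \<Rightarrow> real^'d"
  assumes "P \<in> Hr \<rho> r" "x \<in> Dset \<rho>" "\<forall>i<r. supn (xi i) \<le> a" "0 \<le> a"
  shows "supn (dd (Dset \<rho>) r P xi x) \<le> Hnorm \<rho> r P * a ^ r"
proof -
  have "supn (dd (Dset \<rho>) r P xi x) \<le> mlnorm r (\<lambda>xi. dd (Dset \<rho>) r P xi x) * a ^ r"
    by (rule supn_le_mlnorm_pow[OF Hr_multilinear[OF assms(1) order_refl assms(2)] assms(3)])
  also have "\<dots> \<le> Hnorm \<rho> r P * a ^ r"
    unfolding Hnorm_def using assms(2,4)
    by (intro mult_right_mono cSUP_upper Hnorm_bdd_above[OF assms(1)]) simp_all
  finally show ?thesis .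
qed

lemma supn_le_Hnorm:
  fixes P :: "real^'m \<Rightarrow> real^'d"
  assumes "P \<in> Hr \<rho> r" "x \<in> Dset \<rho>" "\<forall>i<r. supn (xi i) = 1"
  shows "supn (dd (Dset \<rho>) r P xi x) \<le> Hnorm \<rho> r P"
  using supn_le_Hnorm_pow[OF assms(1,2), of xi 1] assms(3) by simp

lemma Hnorm_nonneg:
  fixes P :: "real^'m \<Rightarrow> real^'d"
  assumes "P \<in> Hr \<rho> r"
  shows "0 \<le> Hnorm \<rho> r P"
proof -
  obtain u :: "real^'m" where "supn u = 1" using supn_unit_exists by blast
  then have "supn (dd (Dset \<rho>) r P (\<lambda>_. u) 0) \<le> Hnorm \<rho> r P"
    using rho by (intro supn_le_Hnorm[OF assms zero_in_Dset]) auto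
  then show ?thesis using supn_nonneg by (rule order_trans[rotated])
qed

lemma Hnorm_le:
  fixes P :: "real^'m \<Rightarrow> real^'d"
  assumes "\<And>x xi. x \<in> Dset \<rho> \<Longrightarrow> \<forall>i<r. supn (xi i) = 1 \<Longrightarrow> supn (dd (Dset \<rho>) r P xi x) \<le> C"
  shows "Hnorm \<rho> r P \<le> C"
  unfolding Hnorm_def using zero_in_Dset[of \<rho>] rho
  by (intro cSUP_least mlnorm_le assms) auto

end

text \<open>Linear maps that do not increase the sup norm; they map \<open>D\<close> into itself.\<close>

definition nonexpanding :: "(real^'m \<Rightarrow> real^'m) \<Rightarrow> bool" where
  "nonexpanding T \<longleftrightarrow> linear T \<and> (\<forall>x. supn (T x) \<le> supn x)"

lemma nonexpanding_Dset: "nonexpanding T \<Longrightarrow> T ` Dset \<rho> \<subseteq> Dset \<rho>"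
  unfolding nonexpanding_def Dset_def by (auto intro: order_trans)

lemma nonexpanding_id: "nonexpanding (\<lambda>x. x)"
  unfolding nonexpanding_def by (simp add: linear_id[unfolded id_def])

text \<open>The weighted composition sum \<open>\<Sum>\<^sub>j A\<^sub>j (f\<^sub>j \<circ> T\<^sub>j)\<close> on \<open>D\<close>, extended by zero.
  The operator \<open>L\<close>, its perturbation part, differences and matrix images of elements
  of \<open>H\<^sub>r\<close> all have this shape, so one closure lemma and one norm estimate serve them all.\<close>

definition comp_sum :: "real \<Rightarrow> 'j set \<Rightarrow> ('j \<Rightarrow> real^'d^'e) \<Rightarrow> ('j \<Rightarrow> real^'m \<Rightarrow> real^'d)
    \<Rightarrow> ('j \<Rightarrow> real^'m \<Rightarrow> real^'m) \<Rightarrow> real^'m \<Rightarrow> real^'e" where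
  "comp_sum \<rho> J A f T y = (if y \<in> Dset \<rho> then \<Sum>j\<in>J. A j *v f j (T j y) else 0)"

context fixes \<rho> :: real assumes rho: "\<rho> > 0"
begin

lemma smooth_comp_sum:
  fixes A :: "'j \<Rightarrow> real^'d^'e" and f :: "'j \<Rightarrow> real^'m \<Rightarrow> real^'d"
  assumes J: "finite J" and f: "\<And>j. j \<in> J \<Longrightarrow> smooth (Dset \<rho>) k (f j)"
    and T: "\<And>j. j \<in> J \<Longrightarrow> nonexpanding (T j)"
  shows "smooth (Dset \<rho>) k (comp_sum \<rho> J A f T)"
    and "i \<le> k \<Longrightarrow> x \<in> Dset \<rho> \<Longrightarrow> dd (Dset \<rho>) i (comp_sum \<rho> J A f T) xi x
        = (\<Sum>j\<in>J. A j *v dd (Dset \<rho>) i (f j) (\<lambda>l. T j (xi l)) (T j x))"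
proof -
  define F where "F j y = A j *v f j (T j y)" for j y
  have bl: "bounded_linear (\<lambda>v. A j *v v)" for j using linear_conv_bounded_linear by auto
  have lin: "linear (T j)" and TD: "T j ` Dset \<rho> \<subseteq> Dset \<rho>" if "j \<in> J" for j
    using T[OF that] nonexpanding_Dset unfolding nonexpanding_def by blast+
  have sfT: "smooth (Dset \<rho>) k (\<lambda>y. f j (T j y))" if "j \<in> J" for j
    by (rule smooth_comp(1)[OF rho f[OF that] lin[OF that] TD[OF that]])
  have sF: "smooth (Dset \<rho>) k (F j)" if "j \<in> J" for j
    unfolding F_def by (rule smooth_linear(1)[OF rho sfT[OF that] bl])
  have ddF: "dd (Dset \<rho>) i (F j) xi x = A j *v dd (Dset \<rho>) i (f j) (\<lambda>l. T j (xi l)) (T j x)"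
    if "j \<in> J" "i \<le> k" "x \<in> Dset \<rho>" for i j x
    unfolding F_def smooth_linear(2)[OF rho sfT[OF that(1)] bl that(2,3)]
    using smooth_comp(2)[OF rho f[OF that(1)] lin[OF that(1)] TD[OF that(1)] that(2,3)] by simp
  have sum: "smooth (Dset \<rho>) k (\<lambda>y. \<Sum>j\<in>J. F j y) \<and>
    (\<forall>i\<le>k. \<forall>x\<in>Dset \<rho>. \<forall>xi. dd (Dset \<rho>) i (\<lambda>y. \<Sum>j\<in>J. F j y) xi x = (\<Sum>j\<in>J. dd (Dset \<rho>) i (F j) xi x))"
    by (rule smooth_sum[OF rho J sF])
  have eq: "\<And>y. y \<in> Dset \<rho> \<Longrightarrow> (\<Sum>j\<in>J. F j y) = comp_sum \<rho> J A f T y"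
    unfolding F_def comp_sum_def by simp
  show "smooth (Dset \<rho>) k (comp_sum \<rho> J A f T)" by (rule smooth_cong[OF rho conjunct1[OF sum] eq])
  assume i: "i \<le> k" and x: "x \<in> Dset \<rho>"
  have "dd (Dset \<rho>) i (comp_sum \<rho> J A f T) xi x = dd (Dset \<rho>) i (\<lambda>y. \<Sum>j\<in>J. F j y) xi x"
    by (rule dd_cong[OF _ x]) (simp add: eq)
  then show "dd (Dset \<rho>) i (comp_sum \<rho> J A f T) xi x
        = (\<Sum>j\<in>J. A j *v dd (Dset \<rho>) i (f j) (\<lambda>l. T j (xi l)) (T j x))"
    using sum i x ddF[OF _ i x] by simp
qed

text \<open>Precomposing with a nonexpanding map preserves the continuity of \<open>D\<^sup>r\<close>.\<close>

lemma Hr_continuous_comp: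
  fixes \<phi> :: "real^'m \<Rightarrow> real^'d"
  assumes \<phi>: "\<phi> \<in> Hr \<rho> r" and T: "nonexpanding T" and x: "x \<in> Dset \<rho>"
  shows "((\<lambda>y. mlnorm r (\<lambda>xi. dd (Dset \<rho>) r \<phi> xi (T y) - dd (Dset \<rho>) r \<phi> xi (T x))) \<longlongrightarrow> 0)
    (at x within Dset \<rho>)"
proof -
  define q where "q z = mlnorm r (\<lambda>xi. dd (Dset \<rho>) r \<phi> xi z - dd (Dset \<rho>) r \<phi> xi (T x))" for z
  have TD: "T ` Dset \<rho> \<subseteq> Dset \<rho>" by (rule nonexpanding_Dset[OF T])
  have Tx: "T x \<in> Dset \<rho>" using TD x by blast
  have "q (T x) \<le> 0" unfolding q_def by (rule mlnorm_le) simp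
  moreover have "0 \<le> q (T x)" unfolding q_def
    by (intro mlnorm_nonneg multilinear_diff Hr_multilinear[OF rho \<phi> order_refl Tx])
  ultimately have q0: "q (T x) = 0" by simp
  have "continuous (at (T x) within Dset \<rho>) q"
    unfolding continuous_within q0 unfolding q_def by (rule Hr_continuous[OF rho \<phi> Tx])
  then have "continuous (at (T x) within T ` Dset \<rho>) q" by (rule continuous_within_subset[OF _ TD])
  moreover have "continuous (at x within Dset \<rho>) T"
    using T unfolding nonexpanding_def by (simp add: linear_continuous_within linear_conv_bounded_linear)
  ultimately have "continuous (at x within Dset \<rho>) (\<lambda>y. q (T y))"
    by (rule continuous_within_compose2[rotated])
  then show ?thesis unfolding continuous_within q0 unfolding q_def .
qed

text \<open>The \<open>r\<close>-th derivative of a weighted composition sum is continuous: its oscillation is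
  bounded by \<open>\<Sum>\<^sub>j \<parallel>A\<^sub>j\<parallel>\<close> times the oscillations of \<open>D\<^sup>rf\<^sub>j\<close> at \<open>T\<^sub>j y\<close>, \<open>T\<^sub>j x\<close>.\<close>

lemma comp_sum_dd_continuous:
  fixes A :: "'j \<Rightarrow> real^'d^'e" and f :: "'j \<Rightarrow> real^'m \<Rightarrow> real^'d"
  assumes J: "finite J" and f: "\<And>j. j \<in> J \<Longrightarrow> f j \<in> Hr \<rho> r"
    and T: "\<And>j. j \<in> J \<Longrightarrow> nonexpanding (T j)" and x: "x \<in> Dset \<rho>"
  shows "((\<lambda>y. mlnorm r (\<lambda>xi. dd (Dset \<rho>) r (comp_sum \<rho> J A f T) xi y
      - dd (Dset \<rho>) r (comp_sum \<rho> J A f T) xi x)) \<longlongrightarrow> 0) (at x within Dset \<rho>)"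
proof (rule mlnorm_tendsto_zero)
  have sf: "smooth (Dset \<rho>) r (f j)" if "j \<in> J" for j by (rule Hr_smooth[OF rho f[OF that]])
  note S = smooth_comp_sum[where A=A and f=f and T=T, OF J sf T]
  define M where "M j y = (\<lambda>xi. dd (Dset \<rho>) r (f j) xi (T j y) - dd (Dset \<rho>) r (f j) xi (T j x))" for j y
  show "((\<lambda>y. \<Sum>j\<in>J. opnorm_inf (A j) * mlnorm r (M j y)) \<longlongrightarrow> 0) (at x within Dset \<rho>)"
    unfolding M_def by (intro tendsto_null_sum tendsto_mult_right_zero Hr_continuous_comp[OF f T x])
  fix y :: "real^'m" assume y: "y \<in> Dset \<rho>"
  have TD: "T j y \<in> Dset \<rho>" "T j x \<in> Dset \<rho>" if "j \<in> J" for j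
    using nonexpanding_Dset[OF T[OF that]] x y by blast+
  show "multilinear r (\<lambda>xi. dd (Dset \<rho>) r (comp_sum \<rho> J A f T) xi y
      - dd (Dset \<rho>) r (comp_sum \<rho> J A f T) xi x)"
    by (intro multilinear_diff dd_multilinear[OF rho S(1) order_refl] x y)
  fix xi :: "nat \<Rightarrow> real^'m" assume xi: "\<forall>i<r. supn (xi i) = 1"
  have "dd (Dset \<rho>) r (comp_sum \<rho> J A f T) xi y - dd (Dset \<rho>) r (comp_sum \<rho> J A f T) xi x
      = (\<Sum>j\<in>J. A j *v M j y (\<lambda>l. T j (xi l)))"
    unfolding M_def using x y by (simp add: S(2) sum_subtractf matrix_vector_mult_diff_distrib)
  then have "supn (dd (Dset \<rho>) r (comp_sum \<rho> J A f T) xi y - dd (Dset \<rho>) r (comp_sum \<rho> J A f T) xi x)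
      \<le> (\<Sum>j\<in>J. supn (A j *v M j y (\<lambda>l. T j (xi l))))"
    using supn_sum[OF J] by simp
  also have "\<dots> \<le> (\<Sum>j\<in>J. opnorm_inf (A j) * mlnorm r (M j y))"
  proof (rule sum_mono)
    fix j assume j: "j \<in> J"
    have "\<forall>i<r. supn (T j (xi i)) \<le> 1"
      using T[OF j] xi unfolding nonexpanding_def by metis
    then have "supn (M j y (\<lambda>l. T j (xi l))) \<le> mlnorm r (M j y) * 1 ^ r" unfolding M_def
      by (intro supn_le_mlnorm_pow multilinear_diff Hr_multilinear[OF rho f[OF j] order_refl] TD[OF j])
    then have "opnorm_inf (A j) * supn (M j y (\<lambda>l. T j (xi l))) \<le> opnorm_inf (A j) * mlnorm r (M j y)"
      by (simp add: mult_left_mono opnorm_nonneg)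
    then show "supn (A j *v M j y (\<lambda>l. T j (xi l))) \<le> opnorm_inf (A j) * mlnorm r (M j y)"
      using supn_matrix_le[of "A j" "M j y (\<lambda>l. T j (xi l))"] by linarith
  qed
  finally show "supn (dd (Dset \<rho>) r (comp_sum \<rho> J A f T) xi y - dd (Dset \<rho>) r (comp_sum \<rho> J A f T) xi x)
      \<le> (\<Sum>j\<in>J. opnorm_inf (A j) * mlnorm r (M j y))" .
qed

text \<open>\<open>H\<^sub>r\<close> is closed under weighted composition sums with nonexpanding inner maps.\<close>

lemma Hr_comp_sum:
  fixes A :: "'j \<Rightarrow> real^'d^'e" and f :: "'j \<Rightarrow> real^'m \<Rightarrow> real^'d"
  assumes J: "finite J" and f: "\<And>j. j \<in> J \<Longrightarrow> f j \<in> Hr \<rho> r"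
    and T: "\<And>j. j \<in> J \<Longrightarrow> nonexpanding (T j)"
  shows "comp_sum \<rho> J A f T \<in> Hr \<rho> r"
proof (rule HrI[OF rho _ _ _ comp_sum_dd_continuous[OF J f T]])
  have sf: "smooth (Dset \<rho>) r (f j)" if "j \<in> J" for j by (rule Hr_smooth[OF rho f[OF that]])
  note S = smooth_comp_sum[where A=A and f=f and T=T, OF J sf T]
  show "smooth (Dset \<rho>) r (comp_sum \<rho> J A f T)" by (rule S(1))
  show "comp_sum \<rho> J A f T x = 0" if "x \<notin> Dset \<rho>" for x using that by (simp add: comp_sum_def)
  show "dd (Dset \<rho>) i (comp_sum \<rho> J A f T) xi 0 = 0" if i: "i < r" for i xi
  proof -
    have "T j 0 = 0" if "j \<in> J" for j using T[OF that] by (simp add: nonexpanding_def linear_0)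
    then have "dd (Dset \<rho>) i (f j) (\<lambda>l. T j (xi l)) (T j 0) = 0" if "j \<in> J" for j
      using Hr_dd_at_0[OF rho f[OF that] i] that by simp
    moreover have "dd (Dset \<rho>) i (comp_sum \<rho> J A f T) xi 0
        = (\<Sum>j\<in>J. A j *v dd (Dset \<rho>) i (f j) (\<lambda>l. T j (xi l)) (T j 0))"
      using S(2)[where i=i and x=0] zero_in_Dset[of \<rho>] rho i by simp
    ultimately show ?thesis by simp
  qed
qed

text \<open>The \<open>H\<^sub>r\<close>-norm of a weighted composition sum: if \<open>A\<^sub>j\<close> has norm at most \<open>a\<^sub>j\<close>
  and \<open>T\<^sub>j\<close> has norm at most \<open>c\<^sub>j \<le> 1\<close>, then \<open>\<parallel>\<Sum>\<^sub>j A\<^sub>j (f\<^sub>j \<circ> T\<^sub>j)\<parallel> \<le> \<Sum>\<^sub>j a\<^sub>j c\<^sub>j\<^sup>r \<parallel>f\<^sub>j\<parallel>\<close>.\<close>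

lemma Hnorm_comp_sum_le:
  fixes A :: "'j \<Rightarrow> real^'d^'e" and f :: "'j \<Rightarrow> real^'m \<Rightarrow> real^'d"
  assumes J: "finite J" and f: "\<And>j. j \<in> J \<Longrightarrow> f j \<in> Hr \<rho> r"
    and T: "\<And>j. j \<in> J \<Longrightarrow> nonexpanding (T j)"
    and A: "\<And>j v. j \<in> J \<Longrightarrow> supn (A j *v v) \<le> a j * supn v" "\<And>j. j \<in> J \<Longrightarrow> 0 \<le> a j"
    and c: "\<And>j x. j \<in> J \<Longrightarrow> supn (T j x) \<le> c j * supn x" "\<And>j. j \<in> J \<Longrightarrow> 0 \<le> c j"
  shows "Hnorm \<rho> r (comp_sum \<rho> J A f T) \<le> (\<Sum>j\<in>J. a j * c j ^ r * Hnorm \<rho> r (f j))"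
proof (rule Hnorm_le[OF rho])
  fix x :: "real^'m" and xi :: "nat \<Rightarrow> real^'m"
  assume x: "x \<in> Dset \<rho>" and xi: "\<forall>i<r. supn (xi i) = 1"
  have sf: "smooth (Dset \<rho>) r (f j)" if "j \<in> J" for j by (rule Hr_smooth[OF rho f[OF that]])
  have "supn (dd (Dset \<rho>) r (comp_sum \<rho> J A f T) xi x)
      \<le> (\<Sum>j\<in>J. supn (A j *v dd (Dset \<rho>) r (f j) (\<lambda>l. T j (xi l)) (T j x)))"
    using smooth_comp_sum(2)[where A=A and f=f and T=T, OF J sf T order_refl x] supn_sum[OF J] by simp
  also have "\<dots> \<le> (\<Sum>j\<in>J. a j * c j ^ r * Hnorm \<rho> r (f j))"
  proof (rule sum_mono)
    fix j assume j: "j \<in> J"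
    have "T j x \<in> Dset \<rho>" using nonexpanding_Dset[OF T[OF j]] x by blast
    moreover have "\<forall>i<r. supn (T j (xi i)) \<le> c j" using c(1)[OF j] xi by (metis mult.right_neutral)
    ultimately have "supn (dd (Dset \<rho>) r (f j) (\<lambda>l. T j (xi l)) (T j x)) \<le> Hnorm \<rho> r (f j) * c j ^ r"
      by (intro supn_le_Hnorm_pow[OF rho f[OF j]] c(2)[OF j])
    then show "supn (A j *v dd (Dset \<rho>) r (f j) (\<lambda>l. T j (xi l)) (T j x)) \<le> a j * c j ^ r * Hnorm \<rho> r (f j)"
      using A(1)[OF j] mult_left_mono[OF _ A(2)[OF j]] by (smt (verit) mult.assoc mult.commute)
  qed
  finally show "supn (dd (Dset \<rho>) r (comp_sum \<rho> J A f T) xi x) \<le> (\<Sum>j\<in>J. a j * c j ^ r * Hnorm \<rho> r (f j))" .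
qed

end

text \<open>A difference is a weighted composition sum with weights \<open>\<plusminus>1\<close>.\<close>

lemma diff_eq_comp_sum:
  fixes f g :: "real^'m \<Rightarrow> real^'d"
  assumes "y \<in> Dset \<rho>"
  shows "f y - g y = comp_sum \<rho> UNIV (\<lambda>b. if b then mat 1 else - mat 1) (\<lambda>b. if b then f else g) (\<lambda>_ x. x) y"
  using assms by (simp add: comp_sum_def UNIV_bool matrix_vector_mult_uminus)

context fixes \<rho> :: real assumes rho: "\<rho> > 0"
begin

lemma smooth_diff:
  fixes f g :: "real^'m \<Rightarrow> real^'d"
  assumes f: "smooth (Dset \<rho>) k f" and g: "smooth (Dset \<rho>) k g"
  shows "smooth (Dset \<rho>) k (\<lambda>y. f y - g y)"
    and "j \<le> k \<Longrightarrow> x \<in> Dset \<rho> \<Longrightarrow>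
      dd (Dset \<rho>) j (\<lambda>y. f y - g y) xi x = dd (Dset \<rho>) j f xi x - dd (Dset \<rho>) j g xi x"
proof -
  let ?F = "comp_sum \<rho> UNIV (\<lambda>b. if b then mat 1 else - mat 1) (\<lambda>b. if b then f else g) (\<lambda>_ x. x)"
  have fg: "smooth (Dset \<rho>) k (if b then f else g)" for b using f g by simp
  note S = smooth_comp_sum[where A="\<lambda>b. if b then mat 1 else - mat 1" and f="\<lambda>b. if b then f else g"
      and T="\<lambda>_ x. x", OF rho finite_class.finite_UNIV fg nonexpanding_id]
  show "smooth (Dset \<rho>) k (\<lambda>y. f y - g y)"
    by (rule smooth_cong[OF rho S(1)]) (simp add: diff_eq_comp_sum)
  assume "j \<le> k" "x \<in> Dset \<rho>"
  then show "dd (Dset \<rho>) j (\<lambda>y. f y - g y) xi x = dd (Dset \<rho>) j f xi x - dd (Dset \<rho>) j g xi x"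
    using dd_cong[of "Dset \<rho>" "\<lambda>y. f y - g y" ?F x j xi] S(2)
    by (simp add: diff_eq_comp_sum UNIV_bool matrix_vector_mult_uminus)
qed

lemma Hr_diff:
  fixes f g :: "real^'m \<Rightarrow> real^'d"
  assumes f: "f \<in> Hr \<rho> r" and g: "g \<in> Hr \<rho> r"
  shows "(\<lambda>y. f y - g y) \<in> Hr \<rho> r"
proof -
  have "(\<lambda>y. f y - g y)
      = comp_sum \<rho> UNIV (\<lambda>b. if b then mat 1 else - mat 1) (\<lambda>b. if b then f else g) (\<lambda>_ x. x)"
    using Hr_outside[OF rho f] Hr_outside[OF rho g] diff_eq_comp_sum
    by (fastforce simp: comp_sum_def)
  also have "\<dots> \<in> Hr \<rho> r"
    using f g by (intro Hr_comp_sum[OF rho] nonexpanding_id) auto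
  finally show ?thesis .
qed

text \<open>\<open>(f, g) \<mapsto> \<parallel>f - g\<parallel>\<close> is a pseudometric on \<open>H\<^sub>r\<close>.\<close>

lemma Hnorm_diff_self: "Hnorm \<rho> r (\<lambda>y. f y - f y) = 0" if "f \<in> Hr \<rho> r"
  for f :: "real^'m \<Rightarrow> real^'d"
proof -
  have "Hnorm \<rho> r (\<lambda>y. f y - f y) \<le> 0"
    by (rule Hnorm_le[OF rho]) (simp add: dd_zero[OF rho])
  then show ?thesis using Hnorm_nonneg[OF rho Hr_diff[OF that that]] by simp
qed

lemma Hnorm_diff_triangle:
  fixes f g h :: "real^'m \<Rightarrow> real^'d"
  assumes f: "f \<in> Hr \<rho> r" and g: "g \<in> Hr \<rho> r" and h: "h \<in> Hr \<rho> r"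
  shows "Hnorm \<rho> r (\<lambda>x. f x - h x) \<le> Hnorm \<rho> r (\<lambda>x. f x - g x) + Hnorm \<rho> r (\<lambda>x. g x - h x)"
proof -
  define u where "u b = (if b then (\<lambda>x. f x - g x) else (\<lambda>x. g x - h x))" for b
  have u: "u b \<in> Hr \<rho> r" for b unfolding u_def using Hr_diff f g h by (cases b) simp_all
  have "(\<lambda>x. f x - h x) = comp_sum \<rho> UNIV (\<lambda>_. mat 1) u (\<lambda>_ x. x)"
    using Hr_outside[OF rho f] Hr_outside[OF rho h] by (auto simp: comp_sum_def u_def UNIV_bool)
  moreover have "Hnorm \<rho> r (comp_sum \<rho> UNIV (\<lambda>_. mat 1) u (\<lambda>_ x. x))
      \<le> (\<Sum>b\<in>UNIV. 1 * 1 ^ r * Hnorm \<rho> r (u b))"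
    by (rule Hnorm_comp_sum_le[OF rho finite_class.finite_UNIV u nonexpanding_id]) simp_all
  ultimately show ?thesis by (simp add: UNIV_bool u_def add.commute)
qed

lemma Hnorm_diff_commute:
  fixes f g :: "real^'m \<Rightarrow> real^'d"
  assumes f: "f \<in> Hr \<rho> r" and g: "g \<in> Hr \<rho> r"
  shows "Hnorm \<rho> r (\<lambda>x. f x - g x) = Hnorm \<rho> r (\<lambda>x. g x - f x)"
proof -
  have le: "Hnorm \<rho> r (\<lambda>x. b x - a x) \<le> Hnorm \<rho> r (\<lambda>x. a x - b x)"
    if a: "a \<in> Hr \<rho> r" and b: "b \<in> Hr \<rho> r" for a b :: "real^'m \<Rightarrow> real^'d"
  proof -
    have "(\<lambda>x. b x - a x) = comp_sum \<rho> {()} (\<lambda>_. - mat 1) (\<lambda>_ x. a x - b x) (\<lambda>_ x. x)"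
      using Hr_outside[OF rho a] Hr_outside[OF rho b]
      by (auto simp: comp_sum_def matrix_vector_mult_uminus)
    moreover have "Hnorm \<rho> r (comp_sum \<rho> {()} (\<lambda>_. - mat 1) (\<lambda>_ x. a x - b x) (\<lambda>_ x. x))
        \<le> (\<Sum>_\<in>{()}. 1 * 1 ^ r * Hnorm \<rho> r (\<lambda>x. a x - b x))"
      by (rule Hnorm_comp_sum_le[OF rho])
        (simp_all add: Hr_diff[OF a b] nonexpanding_id matrix_vector_mult_uminus)
    ultimately show ?thesis by simp
  qed
  show ?thesis using le[OF f g] le[OF g f] by simp
qed

text \<open>Bounds on the lower derivatives: since \<open>D\<^sup>kP(0) = 0\<close> for \<open>k < r\<close>, the mean value
  inequality on the convex set \<open>D\<close> of diameter \<open>\<approx>\<rho>\<close> bounds \<open>D\<^sup>kP\<close> by \<open>D\<^sup>k\<^sup>+\<^sup>1P\<close>;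
  iterating down from \<open>k = r\<close> gives \<open>\<parallel>D\<^sup>kP\<parallel> \<le> C\<^sup>r\<^sup>-\<^sup>k \<parallel>P\<parallel>\<close>.\<close>

lemma supn_dd_le_Hnorm_unit:
  fixes P :: "real^'m \<Rightarrow> real^'d"
  assumes P: "P \<in> Hr \<rho> r"
  shows "k \<le> r \<Longrightarrow> y \<in> Dset \<rho> \<Longrightarrow> \<forall>i<k. supn (xi i) = 1 \<Longrightarrow>
    supn (dd (Dset \<rho>) k P xi y) \<le> (real CARD('d) * real CARD('m) * \<rho>) ^ (r - k) * Hnorm \<rho> r P"
proof (induction "r - k" arbitrary: k xi y)
  case 0
  then show ?case using supn_le_Hnorm[OF rho P] by simp
next
  case (Suc n)
  define c where "c = real CARD('d) * real CARD('m) * \<rho>"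
  have kr: "k < r" using Suc by simp
  have D0: "0 \<in> Dset \<rho>" using rho by (simp add: zero_in_Dset)
  define E where "E = c ^ (r - Suc k) * Hnorm \<rho> r P"
  have E0: "0 \<le> E" unfolding E_def c_def using rho Hnorm_nonneg[OF rho P] by simp
  have mlE: "mlnorm (Suc k) (\<lambda>xi. dd (Dset \<rho>) (Suc k) P xi z) \<le> E" if "z \<in> Dset \<rho>" for z
    unfolding E_def c_def using Suc kr that by (intro mlnorm_le Suc.hyps) auto
  define g where "g = dd (Dset \<rho>) k P xi"
  define G where "G z h = dd (Dset \<rho>) (Suc k) P (xi(k := h)) z" for z h
  have gG: "(g has_derivative G z) (at z within Dset \<rho>)" if "z \<in> Dset \<rho>" for z
    unfolding g_def G_def by (rule smooth_has_derivative[OF Hr_smooth[OF rho P] kr that])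
  have "onorm (G z) \<le> real CARD('d) * E" if z: "z \<in> Dset \<rho>" for z
  proof (rule onorm_le)
    fix h :: "real^'m"
    have "supn (G z h) \<le> mlnorm (Suc k) (\<lambda>xi. dd (Dset \<rho>) (Suc k) P xi z) * (\<Prod>i<Suc k. supn ((xi(k := h)) i))"
      unfolding G_def by (rule supn_le_mlnorm_prod[OF Hr_multilinear[OF rho P _ z]]) (use kr in simp)
    also have "(\<Prod>i<Suc k. supn ((xi(k := h)) i)) = supn h" using Suc.prems(3) by simp
    finally have "supn (G z h) \<le> E * supn h"
      using mlE[OF z] supn_nonneg[of h] by (meson mult_right_mono order_trans)
    then show "norm (G z h) \<le> real CARD('d) * E * norm h"
      using norm_le_supn[of "G z h"] supn_le_norm[of h] E0
      by (smt (verit) mult_left_mono mult_nonneg_nonneg of_nat_0_le_iff mult.assoc)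
  qed
  then have "norm (g y - g 0) \<le> real CARD('d) * E * norm (y - 0)"
    by (intro differentiable_bound[OF convex_Dset gG _ Suc.prems(2) D0]) auto
  moreover have "g 0 = 0" unfolding g_def using Hr_dd_at_0[OF rho P kr] .
  ultimately have "norm (g y) \<le> real CARD('d) * E * (real CARD('m) * \<rho>)"
    using norm_le_on_Dset[OF Suc.prems(2)] E0
    by (smt (verit) diff_zero mult_left_mono mult_nonneg_nonneg of_nat_0_le_iff)
  then have "supn (g y) \<le> c * E" unfolding c_def using supn_le_norm[of "g y"] by (simp add: algebra_simps)
  also have "c * E = c ^ (r - k) * Hnorm \<rho> r P" unfolding E_def using kr
    by (metis Suc_diff_Suc mult.assoc power_Suc)
  finally show ?case unfolding g_def c_def .
qed

lemma supn_dd_le_Hnorm: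
  fixes P :: "real^'m \<Rightarrow> real^'d"
  assumes P: "P \<in> Hr \<rho> r" and "k \<le> r" "y \<in> Dset \<rho>"
  shows "supn (dd (Dset \<rho>) k P xi y)
    \<le> (real CARD('d) * real CARD('m) * \<rho>) ^ (r - k) * Hnorm \<rho> r P * (\<Prod>i<k. supn (xi i))"
proof -
  have "mlnorm k (\<lambda>xi. dd (Dset \<rho>) k P xi y) \<le> (real CARD('d) * real CARD('m) * \<rho>) ^ (r - k) * Hnorm \<rho> r P"
    by (rule mlnorm_le) (rule supn_dd_le_Hnorm_unit[OF P assms(2,3)])
  then show ?thesis
    using supn_le_mlnorm_prod[OF Hr_multilinear[OF rho P assms(2,3)], of xi]
    by (meson mult_right_mono order_trans prod_nonneg supn_nonneg)
qed

text \<open>Consequently \<open>\<parallel>\<cdot>\<parallel>\<close> is a norm on \<open>H\<^sub>r\<close>, not only a seminorm.\<close>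

lemma Hnorm_eq_0_imp_zero:
  fixes P :: "real^'m \<Rightarrow> real^'d"
  assumes P: "P \<in> Hr \<rho> r" and "Hnorm \<rho> r P \<le> 0"
  shows "P x = 0"
proof (cases "x \<in> Dset \<rho>")
  case True
  have "supn (dd (Dset \<rho>) 0 P (\<lambda>_. 0) x) \<le> (real CARD('d) * real CARD('m) * \<rho>) ^ r * Hnorm \<rho> r P"
    using supn_dd_le_Hnorm_unit[OF P, where k=0 and xi="\<lambda>_. 0", OF _ True] by simp
  also have "\<dots> \<le> 0" using assms(2) rho by (simp add: mult_nonneg_nonpos)
  finally show ?thesis using supn_nonneg[of "P x"] supn_eq_0_iff[of "P x"] by simp
qed (rule Hr_outside[OF rho P])

end

text \<open>Two facts about limits of sequences: a Cauchy criterion with an explicit rate, and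
  passing a sup-norm bound to the limit.\<close>

lemma Cauchy_if_dist_bound:
  fixes X :: "nat \<Rightarrow> 'a::metric_space"
  assumes "\<And>n m. n \<le> m \<Longrightarrow> dist (X m) (X n) \<le> b n" "b \<longlonglongrightarrow> 0"
  shows "Cauchy X"
  unfolding Cauchy_def
proof (intro allI impI)
  fix \<epsilon> :: real assume "\<epsilon> > 0"
  then obtain N where N: "b N < \<epsilon> / 2"
    using order_tendstoD(2)[OF assms(2), of "\<epsilon>/2"] eventually_sequentially by auto
  have "dist (X m) (X n) < \<epsilon>" if "N \<le> m" "N \<le> n" for m n
    using dist_triangle2[of "X m" "X n" "X N"] assms(1)[OF that(1)] assms(1)[OF that(2)] N by linarith
  then show "\<exists>M. \<forall>m\<ge>M. \<forall>n\<ge>M. dist (X m) (X n) < \<epsilon>" by blast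
qed

lemma supn_limit_le:
  assumes "X \<longlonglongrightarrow> L" "\<And>m. n \<le> m \<Longrightarrow> supn (X m - y) \<le> B"
  shows "supn (L - y) \<le> B"
  unfolding supn_le_iff
proof
  fix i
  have "(\<lambda>m. \<bar>(X m - y) $ i\<bar>) \<longlonglongrightarrow> \<bar>(L - y) $ i\<bar>"
    by (intro tendsto_intros tendsto_vec_nth assms(1))
  moreover have "\<exists>N. \<forall>m\<ge>N. \<bar>(X m - y) $ i\<bar> \<le> B"
    using assms(2) supn_ge order_trans by blast
  ultimately show "\<bar>(L - y) $ i\<bar> \<le> B" by (rule LIMSEQ_le_const2)
qed

text \<open>Completeness of \<open>H\<^sub>r\<close>: a sequence \<open>\<phi>\<^sub>n\<close> with \<open>\<parallel>\<phi>\<^sub>m - \<phi>\<^sub>n\<parallel> \<le> e\<^sub>n\<close> for \<open>n \<le> m\<close>,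
  \<open>e\<^sub>n \<rightarrow> 0\<close>. By the lower-derivative bounds all derivatives \<open>D\<^sup>k\<phi>\<^sub>n\<close>, \<open>k \<le> r\<close>, converge
  uniformly on \<open>D\<close>; the limit of the derivatives is the derivative of the limit.\<close>

locale Hr_Cauchy =
  fixes \<rho> :: real and r :: nat and \<phi>s :: "nat \<Rightarrow> real^'m \<Rightarrow> real^'d" and e :: "nat \<Rightarrow> real"
  assumes rho: "\<rho> > 0"
    and mem: "\<And>n. \<phi>s n \<in> Hr \<rho> r"
    and Hnorm_Cauchy: "\<And>n m. n \<le> m \<Longrightarrow> Hnorm \<rho> r (\<lambda>x. \<phi>s m x - \<phi>s n x) \<le> e n"
    and e_lim: "e \<longlonglongrightarrow> 0"
begin

definition lim_dd :: "nat \<Rightarrow> (nat \<Rightarrow> real^'m) \<Rightarrow> real^'m \<Rightarrow> real^'d" where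
  "lim_dd k xi z = lim (\<lambda>n. dd (Dset \<rho>) k (\<phi>s n) xi z)"

definition limit :: "real^'m \<Rightarrow> real^'d" where
  "limit y = (if y \<in> Dset \<rho> then lim_dd 0 (\<lambda>_. 0) y else 0)"

lemma zero_in_D: "0 \<in> Dset \<rho>"
  using rho by (simp add: zero_in_Dset)

lemma e_nonneg: "0 \<le> e n"
  using Hnorm_nonneg[OF rho Hr_diff[OF rho mem mem], of n n] Hnorm_Cauchy[of n n] by simp

lemma smooth_seq: "smooth (Dset \<rho>) r (\<phi>s n)"
  by (rule Hr_smooth[OF rho mem])

text \<open>The derivative sequences are uniformly Cauchy on \<open>D\<close>, by the lower-derivative bound
  applied to \<open>\<phi>\<^sub>m - \<phi>\<^sub>n\<close>; hence they converge, at the same rate.\<close>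

lemma dd_Cauchy:
  assumes "n \<le> m" "k \<le> r" "z \<in> Dset \<rho>"
  shows "supn (dd (Dset \<rho>) k (\<phi>s m) xi z - dd (Dset \<rho>) k (\<phi>s n) xi z)
    \<le> (real CARD('d) * real CARD('m) * \<rho>) ^ (r - k) * e n * (\<Prod>i<k. supn (xi i))"
proof -
  have "supn (dd (Dset \<rho>) k (\<lambda>x. \<phi>s m x - \<phi>s n x) xi z)
      \<le> (real CARD('d) * real CARD('m) * \<rho>) ^ (r - k) * Hnorm \<rho> r (\<lambda>x. \<phi>s m x - \<phi>s n x)
        * (\<Prod>i<k. supn (xi i))"
    by (rule supn_dd_le_Hnorm[OF rho Hr_diff[OF rho mem mem] assms(2,3)])
  also have "\<dots> \<le> (real CARD('d) * real CARD('m) * \<rho>) ^ (r - k) * e n * (\<Prod>i<k. supn (xi i))"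
    using rho Hnorm_Cauchy[OF assms(1)] by (intro mult_right_mono mult_left_mono) (auto intro: prod_nonneg supn_nonneg)
  finally show ?thesis
    using smooth_diff(2)[OF rho smooth_seq smooth_seq assms(2,3)] by simp
qed

lemma dd_tendsto:
  assumes "k \<le> r" "z \<in> Dset \<rho>"
  shows "(\<lambda>n. dd (Dset \<rho>) k (\<phi>s n) xi z) \<longlonglongrightarrow> lim_dd k xi z"
proof -
  define b where "b n = real CARD('d) * ((real CARD('d) * real CARD('m) * \<rho>) ^ (r - k) * e n * (\<Prod>i<k. supn (xi i)))" for n
  have "Cauchy (\<lambda>n. dd (Dset \<rho>) k (\<phi>s n) xi z)"
  proof (rule Cauchy_if_dist_bound)
    fix n m :: nat assume nm: "n \<le> m"
    have "dist (dd (Dset \<rho>) k (\<phi>s m) xi z) (dd (Dset \<rho>) k (\<phi>s n) xi z)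
        \<le> real CARD('d) * supn (dd (Dset \<rho>) k (\<phi>s m) xi z - dd (Dset \<rho>) k (\<phi>s n) xi z)"
      unfolding dist_norm by (rule norm_le_supn)
    also have "\<dots> \<le> b n"
      unfolding b_def by (rule mult_left_mono[OF dd_Cauchy[OF nm assms]]) simp
    finally show "dist (dd (Dset \<rho>) k (\<phi>s m) xi z) (dd (Dset \<rho>) k (\<phi>s n) xi z) \<le> b n" .
  next
    show "b \<longlonglongrightarrow> 0" unfolding b_def
      by (intro tendsto_mult_right_zero tendsto_mult_left_zero tendsto_mult_right_zero e_lim)
  qed
  then show ?thesis unfolding lim_dd_def by (simp add: Cauchy_convergent_iff convergent_LIMSEQ_iff)
qed

lemma lim_dd_approx:
  assumes "k \<le> r" "z \<in> Dset \<rho>"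
  shows "supn (lim_dd k xi z - dd (Dset \<rho>) k (\<phi>s n) xi z)
    \<le> (real CARD('d) * real CARD('m) * \<rho>) ^ (r - k) * e n * (\<Prod>i<k. supn (xi i))"
  by (rule supn_limit_le[OF dd_tendsto[OF assms]]) (rule dd_Cauchy[OF _ assms])

text \<open>Uniform convergence of the derivatives makes the limit differentiable, with the
  limit of the derivatives as derivative.\<close>

text \<open>Uniform convergence of the \<open>(k+1)\<close>-th derivatives, in the form required by
  the library theorem on limits of derivatives.\<close>

lemma dd_Suc_uniform:
  assumes k: "k < r" and eps: "\<epsilon> > 0"
  shows "\<forall>\<^sub>F n in sequentially. \<forall>w\<in>Dset \<rho>. \<forall>h.
    norm (dd (Dset \<rho>) (Suc k) (\<phi>s n) (xi(k := h)) w - lim_dd (Suc k) (xi(k := h)) w) \<le> \<epsilon> * norm h"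
proof -
  define c where "c = real CARD('d) * (real CARD('d) * real CARD('m) * \<rho>) ^ (r - Suc k) * (\<Prod>i<k. supn (xi i))"
  have c0: "0 \<le> c" unfolding c_def using rho
    by (intro mult_nonneg_nonneg zero_le_power prod_nonneg) (auto simp: supn_nonneg)
  have "\<forall>\<^sub>F n in sequentially. e n < \<epsilon> / (c + 1)"
    using order_tendstoD(2)[OF e_lim, of "\<epsilon> / (c + 1)"] eps c0 by simp
  then show ?thesis
  proof (rule eventually_mono)
    fix n assume en: "e n < \<epsilon> / (c + 1)"
    have "c * e n \<le> (c + 1) * e n" using e_nonneg[of n] by (simp add: algebra_simps)
    also have "\<dots> \<le> \<epsilon>" using en c0 by (simp add: field_simps)
    finally have ce: "c * e n \<le> \<epsilon>" .
    show "\<forall>w\<in>Dset \<rho>. \<forall>h. norm (dd (Dset \<rho>) (Suc k) (\<phi>s n) (xi(k := h)) w - lim_dd (Suc k) (xi(k := h)) w)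
        \<le> \<epsilon> * norm h"
    proof (intro ballI allI)
      fix w h :: "real^'m" assume w: "w \<in> Dset \<rho>"
      have "norm (dd (Dset \<rho>) (Suc k) (\<phi>s n) (xi(k := h)) w - lim_dd (Suc k) (xi(k := h)) w)
          \<le> real CARD('d) * supn (lim_dd (Suc k) (xi(k := h)) w - dd (Dset \<rho>) (Suc k) (\<phi>s n) (xi(k := h)) w)"
        using norm_le_supn by (metis norm_minus_commute)
      also have "\<dots> \<le> c * e n * supn h"
        using mult_left_mono[OF lim_dd_approx[OF _ w, of "Suc k" "xi(k := h)" n], of "real CARD('d)"] k
        by (simp add: c_def mult_ac)
      also have "\<dots> \<le> \<epsilon> * norm h"
        using ce supn_le_norm[of h] supn_nonneg[of h] c0 e_nonneg[of n] eps
        by (meson mult_mono mult_nonneg_nonneg order_trans less_imp_le)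
      finally show "norm (dd (Dset \<rho>) (Suc k) (\<phi>s n) (xi(k := h)) w - lim_dd (Suc k) (xi(k := h)) w)
        \<le> \<epsilon> * norm h" .
    qed
  qed
qed

lemma lim_dd_has_derivative:
  assumes k: "k < r" and z: "z \<in> Dset \<rho>"
  shows "(lim_dd k xi has_derivative (\<lambda>h. lim_dd (Suc k) (xi(k := h)) z)) (at z within Dset \<rho>)"
proof -
  have deriv: "(dd (Dset \<rho>) k (\<phi>s n) xi has_derivative (\<lambda>h. dd (Dset \<rho>) (Suc k) (\<phi>s n) (xi(k := h)) w))
      (at w within Dset \<rho>)" if "w \<in> Dset \<rho>" for n w
    by (rule smooth_has_derivative[OF smooth_seq k that])
  obtain g where g: "\<And>w. w \<in> Dset \<rho> \<Longrightarrow> (\<lambda>n. dd (Dset \<rho>) k (\<phi>s n) xi w) \<longlonglongrightarrow> g w \<and>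
      (g has_derivative (\<lambda>h. lim_dd (Suc k) (xi(k := h)) w)) (at w within Dset \<rho>)"
    using has_derivative_sequence[OF convex_Dset deriv dd_Suc_uniform[OF k] zero_in_D dd_tendsto[OF _ zero_in_D]] k
    by (metis less_imp_le)
  have "g w = lim_dd k xi w" if "w \<in> Dset \<rho>" for w
    using LIMSEQ_unique[OF conjunct1[OF g[OF that]] dd_tendsto[OF _ that]] k by simp
  then show ?thesis using g[OF z] has_derivative_within_cong[OF z] by metis
qed

lemma smooth_limit:
  "k \<le> r \<Longrightarrow> smooth (Dset \<rho>) k limit \<and> (\<forall>xi. \<forall>z\<in>Dset \<rho>. dd (Dset \<rho>) k limit xi z = lim_dd k xi z)"
proof (induction k)
  case 0
  have "lim_dd 0 (\<lambda>_. 0) z = lim_dd 0 xi z" for xi z unfolding lim_dd_def by simp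
  then show ?case by (simp add: smooth_def limit_def)
next
  case (Suc k)
  then have k: "k < r" and IH: "smooth (Dset \<rho>) k limit" "\<And>xi z. z \<in> Dset \<rho> \<Longrightarrow> dd (Dset \<rho>) k limit xi z = lim_dd k xi z"
    by auto
  have der: "(dd (Dset \<rho>) k limit xi has_derivative (\<lambda>h. lim_dd (Suc k) (xi(k := h)) z)) (at z within Dset \<rho>)"
    if z: "z \<in> Dset \<rho>" for xi z
    using lim_dd_has_derivative[OF k z] has_derivative_within_cong[OF z IH(2)] by simp
  have "smooth (Dset \<rho>) (Suc k) limit"
    unfolding smooth_def
  proof (intro allI impI ballI)
    fix j xi and z :: "real^'m" assume j: "j < Suc k" and z: "z \<in> Dset \<rho>"
    show "(\<lambda>y. dd (Dset \<rho>) j limit xi y) differentiable (at z within Dset \<rho>)"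
    proof (cases "j < k")
      case True then show ?thesis using smoothD[OF IH(1) True z] by simp
    next
      case False then show ?thesis using der[OF z] j unfolding differentiable_def by (metis less_SucE)
    qed
  qed
  moreover have "dd (Dset \<rho>) (Suc k) limit xi z = lim_dd (Suc k) xi z" if z: "z \<in> Dset \<rho>" for xi z
    using frechet_derivative_Dset[OF rho z der[OF z]] by simp
  ultimately show ?case by blast
qed

lemma smooth_limit_r: "smooth (Dset \<rho>) r limit"
  and dd_limit: "z \<in> Dset \<rho> \<Longrightarrow> dd (Dset \<rho>) r limit xi z = lim_dd r xi z"
  using smooth_limit[of r] by auto

lemma dd_limit_approx:
  assumes "z \<in> Dset \<rho>" "\<forall>i<r. supn (xi i) = 1"
  shows "supn (dd (Dset \<rho>) r (\<phi>s n) xi z - dd (Dset \<rho>) r limit xi z) \<le> e n"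
  using lim_dd_approx[OF order_refl assms(1), of xi n] assms by (simp add: dd_limit supn_minus_commute)

text \<open>\<open>D\<^sup>r\<close> of the limit is continuous: it is a uniform limit of continuous maps.\<close>

lemma limit_continuous:
  assumes x: "x \<in> Dset \<rho>"
  shows "((\<lambda>y. mlnorm r (\<lambda>xi. dd (Dset \<rho>) r limit xi y - dd (Dset \<rho>) r limit xi x)) \<longlongrightarrow> 0)
    (at x within Dset \<rho>)"
  unfolding tendsto_iff
proof (intro allI impI)
  fix \<epsilon> :: real assume eps: "\<epsilon> > 0"
  obtain n where n: "e n < \<epsilon> / 4"
    using order_tendstoD(2)[OF e_lim, of "\<epsilon>/4"] eps eventually_sequentially by auto
  define M where "M y = (\<lambda>xi. dd (Dset \<rho>) r (\<phi>s n) xi y - dd (Dset \<rho>) r (\<phi>s n) xi x)" for y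
  have "\<forall>\<^sub>F y in at x within Dset \<rho>. dist (mlnorm r (M y)) 0 < \<epsilon> / 4"
    unfolding M_def by (rule tendstoD[OF Hr_continuous[OF rho mem x]]) (use eps in simp)
  moreover have "\<forall>\<^sub>F y in at x within Dset \<rho>. y \<in> Dset \<rho>" unfolding eventually_at_filter by simp
  ultimately show "\<forall>\<^sub>F y in at x within Dset \<rho>.
      dist (mlnorm r (\<lambda>xi. dd (Dset \<rho>) r limit xi y - dd (Dset \<rho>) r limit xi x)) 0 < \<epsilon>"
  proof eventually_elim
    case (elim y)
    then have y: "y \<in> Dset \<rho>" and m: "mlnorm r (M y) < \<epsilon> / 4" by auto
    have "mlnorm r (\<lambda>xi. dd (Dset \<rho>) r limit xi y - dd (Dset \<rho>) r limit xi x) \<le> e n + mlnorm r (M y) + e n"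
    proof (rule mlnorm_le)
      fix xi :: "nat \<Rightarrow> real^'m" assume xi: "\<forall>i<r. supn (xi i) = 1"
      have "dd (Dset \<rho>) r limit xi y - dd (Dset \<rho>) r limit xi x
          = (dd (Dset \<rho>) r limit xi y - dd (Dset \<rho>) r (\<phi>s n) xi y) + M y xi
            + (dd (Dset \<rho>) r (\<phi>s n) xi x - dd (Dset \<rho>) r limit xi x)"
        unfolding M_def by simp
      then have "supn (dd (Dset \<rho>) r limit xi y - dd (Dset \<rho>) r limit xi x)
          \<le> supn (dd (Dset \<rho>) r limit xi y - dd (Dset \<rho>) r (\<phi>s n) xi y) + supn (M y xi)
            + supn (dd (Dset \<rho>) r (\<phi>s n) xi x - dd (Dset \<rho>) r limit xi x)"
        using supn_add[of "_ + M y xi"] supn_add[of _ "M y xi"] by (smt (verit))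
      moreover have "supn (M y xi) \<le> mlnorm r (M y)" unfolding M_def
        by (intro supn_le_mlnorm[OF _ xi] multilinear_diff Hr_multilinear[OF rho mem order_refl] x y)
      ultimately show "supn (dd (Dset \<rho>) r limit xi y - dd (Dset \<rho>) r limit xi x) \<le> e n + mlnorm r (M y) + e n"
        using dd_limit_approx[OF y xi, of n] dd_limit_approx[OF x xi, of n] by (simp add: supn_minus_commute)
    qed
    moreover have "0 \<le> mlnorm r (\<lambda>xi. dd (Dset \<rho>) r limit xi y - dd (Dset \<rho>) r limit xi x)"
      by (intro mlnorm_nonneg multilinear_diff dd_multilinear[OF rho smooth_limit_r order_refl] x y)
    ultimately show ?case using m n by simp
  qed
qed

lemma limit_in_Hr: "limit \<in> Hr \<rho> r"
proof (rule HrI[OF rho smooth_limit_r _ _ limit_continuous])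
  show "limit x = 0" if "x \<notin> Dset \<rho>" for x using that by (simp add: limit_def)
  fix i xi assume i: "i < r"
  have "(\<lambda>n. dd (Dset \<rho>) i (\<phi>s n) xi 0) \<longlonglongrightarrow> lim_dd i xi 0"
    using i by (intro dd_tendsto zero_in_D) simp
  then have "(\<lambda>n. 0) \<longlonglongrightarrow> lim_dd i xi 0" using Hr_dd_at_0[OF rho mem i] by simp
  then have "lim_dd i xi 0 = 0" using LIMSEQ_unique tendsto_const by metis
  moreover have "dd (Dset \<rho>) i limit xi 0 = lim_dd i xi 0"
    using smooth_limit[OF less_imp_le[OF i]] zero_in_D by blast
  ultimately show "dd (Dset \<rho>) i limit xi 0 = 0" by simp
qed

lemma Hnorm_diff_limit: "Hnorm \<rho> r (\<lambda>x. \<phi>s n x - limit x) \<le> e n"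
proof (rule Hnorm_le[OF rho])
  fix z :: "real^'m" and xi :: "nat \<Rightarrow> real^'m" assume z: "z \<in> Dset \<rho>" and xi: "\<forall>i<r. supn (xi i) = 1"
  then show "supn (dd (Dset \<rho>) r (\<lambda>x. \<phi>s n x - limit x) xi z) \<le> e n"
    using dd_limit_approx[OF z xi] smooth_diff(2)[OF rho smooth_seq smooth_limit_r order_refl z] by simp
qed

end

lemma Hr_complete:
  fixes \<phi>s :: "nat \<Rightarrow> real^'m \<Rightarrow> real^'d"
  assumes "\<rho> > 0" "\<And>n. \<phi>s n \<in> Hr \<rho> r"
    and "\<And>n m. n \<le> m \<Longrightarrow> Hnorm \<rho> r (\<lambda>x. \<phi>s m x - \<phi>s n x) \<le> e n" "e \<longlonglongrightarrow> 0"
  shows "\<exists>\<phi>\<in>Hr \<rho> r. \<forall>n. Hnorm \<rho> r (\<lambda>x. \<phi>s n x - \<phi> x) \<le> e n"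
proof -
  interpret Hr_Cauchy \<rho> r \<phi>s e using assms by unfold_locales
  show ?thesis using limit_in_Hr Hnorm_diff_limit by blast
qed

text \<open>Banach's fixed point theorem for a set \<open>H\<close> carrying a complete distance \<open>d\<close>
  (given as a function, since \<open>H\<^sub>r\<close> is not a type of its own).\<close>

locale complete_contraction =
  fixes H :: "'a set" and d :: "'a \<Rightarrow> 'a \<Rightarrow> real" and F :: "'a \<Rightarrow> 'a" and q :: real
  assumes F_into: "\<And>x. x \<in> H \<Longrightarrow> F x \<in> H"
    and d_self: "\<And>x. x \<in> H \<Longrightarrow> d x x = 0"
    and d_sym: "\<And>x y. x \<in> H \<Longrightarrow> y \<in> H \<Longrightarrow> d x y = d y x"
    and d_triangle: "\<And>x y z. x \<in> H \<Longrightarrow> y \<in> H \<Longrightarrow> z \<in> H \<Longrightarrow> d x z \<le> d x y + d y z"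
    and d_definite: "\<And>x y. x \<in> H \<Longrightarrow> y \<in> H \<Longrightarrow> d x y \<le> 0 \<Longrightarrow> x = y"
    and complete: "\<And>s e. (\<And>n. s n \<in> H) \<Longrightarrow> (\<And>n m. n \<le> m \<Longrightarrow> d (s m) (s n) \<le> e n) \<Longrightarrow>
      e \<longlonglongrightarrow> 0 \<Longrightarrow> \<exists>x\<in>H. \<forall>n. d (s n) x \<le> e n"
    and contraction: "\<And>x y. x \<in> H \<Longrightarrow> y \<in> H \<Longrightarrow> d (F x) (F y) \<le> q * d x y"
    and q_nonneg: "0 \<le> q" and q_less_1: "q < 1"
begin

lemma d_nonneg: "x \<in> H \<Longrightarrow> y \<in> H \<Longrightarrow> 0 \<le> d x y"
  using d_triangle[of x y x] d_self[of x] d_sym[of x y] by simp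

text \<open>The Picard iterates form a Cauchy sequence with geometric rate.\<close>

lemma iterates_Cauchy:
  assumes x0: "x0 \<in> H" and nm: "n \<le> m"
  shows "d ((F ^^ m) x0) ((F ^^ n) x0) \<le> q ^ n / (1 - q) * d (F x0) x0"
proof -
  define s where "s n = (F ^^ n) x0" for n
  define d1 where "d1 = d (F x0) x0"
  have s: "s n \<in> H" for n unfolding s_def by (induction n) (simp_all add: x0 F_into)
  have d1: "0 \<le> d1" unfolding d1_def by (intro d_nonneg F_into x0)
  have step: "d (s (Suc k)) (s k) \<le> q ^ k * d1" for k
  proof (induction k)
    case (Suc k)
    have "d (s (Suc (Suc k))) (s (Suc k)) \<le> q * d (s (Suc k)) (s k)"
      unfolding s_def funpow.simps o_def by (intro contraction F_into s[unfolded s_def])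
    also have "\<dots> \<le> q * (q ^ k * d1)" by (rule mult_left_mono[OF Suc q_nonneg])
    finally show ?case by simp
  qed (simp add: s_def d1_def)
  have geom: "d (s (n + p)) (s n) \<le> (q ^ n - q ^ (n + p)) / (1 - q) * d1" for p
  proof (induction p)
    case 0 then show ?case by (simp add: d_self s)
  next
    case (Suc p)
    have "d (s (n + Suc p)) (s n) \<le> d (s (Suc (n + p))) (s (n + p)) + d (s (n + p)) (s n)"
      using d_triangle s by simp
    also have "\<dots> \<le> q ^ (n + p) * d1 + (q ^ n - q ^ (n + p)) / (1 - q) * d1"
      by (rule add_mono[OF step Suc])
    also have "\<dots> = (q ^ n - q ^ (n + Suc p)) / (1 - q) * d1"
      using q_less_1 by (simp add: field_simps)
    finally show ?case .
  qed
  have "(q ^ n - q ^ m) / (1 - q) * d1 \<le> q ^ n / (1 - q) * d1"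
    using q_less_1 q_nonneg d1 by (intro mult_right_mono divide_right_mono) auto
  moreover have "m = n + (m - n)" using nm by simp
  ultimately show ?thesis
    using geom[of "m - n"] unfolding s_def d1_def by simp
qed

lemma fixpoint_exists: "x0 \<in> H \<Longrightarrow> \<exists>x\<in>H. F x = x"
proof -
  assume x0: "x0 \<in> H"
  define s where "s n = (F ^^ n) x0" for n
  define e where "e n = q ^ n / (1 - q) * d (F x0) x0" for n
  have s: "s n \<in> H" for n unfolding s_def by (induction n) (simp_all add: x0 F_into)
  have "(\<lambda>n. q ^ n) \<longlonglongrightarrow> 0" using q_nonneg q_less_1 by (intro LIMSEQ_power_zero) simp
  from tendsto_mult_right_zero[OF this, of "d (F x0) x0 / (1 - q)"]
  have "(\<lambda>n. d (F x0) x0 / (1 - q) * q ^ n) \<longlonglongrightarrow> 0" .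
  moreover have "e = (\<lambda>n. d (F x0) x0 / (1 - q) * q ^ n)" unfolding e_def by (simp add: fun_eq_iff)
  ultimately have e: "e \<longlonglongrightarrow> 0" by simp
  have "\<exists>x\<in>H. \<forall>n. d (s n) x \<le> e n"
  proof (rule complete[OF s _ e])
    show "d (s m) (s n) \<le> e n" if "n \<le> m" for n m
      unfolding s_def e_def by (rule iterates_Cauchy[OF x0 that])
  qed
  then obtain x where x: "x \<in> H" and sx: "\<And>n. d (s n) x \<le> e n" by blast
  have "d (F x) x \<le> q * e n + e (Suc n)" for n
  proof -
    have "d (F x) x \<le> d (F x) (F (s n)) + d (F (s n)) x" by (intro d_triangle F_into x s)
    also have "d (F x) (F (s n)) \<le> q * d (s n) x"
      using contraction[OF x s] d_sym[OF x s] by simp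
    also have "F (s n) = s (Suc n)" by (simp add: s_def)
    finally show ?thesis using mult_left_mono[OF sx q_nonneg, of n] sx[of "Suc n"] by linarith
  qed
  then have "d (F x) x \<le> 0"
    by (intro LIMSEQ_le_const[OF tendsto_add_zero[OF tendsto_mult_right_zero[OF e] LIMSEQ_Suc[OF e]]]) auto
  then show ?thesis using d_definite F_into x by blast
qed

lemma fixpoint_unique:
  assumes "x \<in> H" "y \<in> H" "F x = x" "F y = y"
  shows "x = y"
proof -
  have "d x y \<le> q * d x y" using contraction[OF assms(1,2)] assms(3,4) by simp
  then have "d x y \<le> 0" using q_less_1 d_nonneg[OF assms(1,2)] by (simp add: mult_le_cancel_right1)
  then show ?thesis by (rule d_definite[OF assms(1,2)])
qed

end

text \<open>\<open>matrix_inv\<close> is defined by choice; for invertible matrices it is a two-sided inverse.\<close>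

lemma matrix_inv_left: "invertible A \<Longrightarrow> matrix_inv A ** A = mat 1"
  and matrix_inv_right: "invertible A \<Longrightarrow> A ** matrix_inv A = mat 1"
  unfolding invertible_def matrix_inv_def by (metis (mono_tags, lifting) someI_ex)+

text \<open>Weighted composition sums are linear in the functions \<open>f\<^sub>j\<close>.\<close>

lemma comp_sum_diff:
  "comp_sum \<rho> J A f T x - comp_sum \<rho> J A g T x = comp_sum \<rho> J A (\<lambda>j y. f j y - g j y) T x"
  by (simp add: comp_sum_def sum_subtractf matrix_vector_mult_diff_distrib)

text \<open>The iterates \<open>\<Lambda>\<^sup>j\<close> have norm at most \<open>\<parallel>\<Lambda>\<parallel>\<^sup>j\<close>, so they are nonexpanding if \<open>\<parallel>\<Lambda>\<parallel> \<le> 1\<close>.\<close>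

lemma supn_Lambda_pow_le:
  fixes \<Lambda> :: "real^'m^'m"
  shows "supn (((*v) \<Lambda> ^^ j) x) \<le> opnorm_inf \<Lambda> ^ j * supn x"
proof (induction j)
  case (Suc j)
  have "supn (((*v) \<Lambda> ^^ Suc j) x) \<le> opnorm_inf \<Lambda> * supn (((*v) \<Lambda> ^^ j) x)"
    using supn_matrix_le[of \<Lambda> "((*v) \<Lambda> ^^ j) x"] by simp
  also have "\<dots> \<le> opnorm_inf \<Lambda> * (opnorm_inf \<Lambda> ^ j * supn x)"
    by (rule mult_left_mono[OF Suc opnorm_nonneg])
  finally show ?case by (simp add: mult.assoc)
qed simp

lemma nonexpanding_Lambda_pow:
  fixes \<Lambda> :: "real^'m^'m"
  assumes "opnorm_inf \<Lambda> \<le> 1"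
  shows "nonexpanding ((*v) \<Lambda> ^^ j)"
  unfolding nonexpanding_def
proof
  show "linear ((*v) \<Lambda> ^^ j)"
  proof (induction j)
    case (Suc j)
    then show ?case using linear_compose[OF Suc matrix_vector_mul_linear[of \<Lambda>]] by (simp add: o_def)
  qed (simp add: linear_id[unfolded id_def])
  have "opnorm_inf \<Lambda> ^ j * supn x \<le> supn x" for x
    using mult_right_mono[OF power_le_one[OF opnorm_nonneg assms] supn_nonneg[of x]] by simp
  then show "\<forall>x. supn (((*v) \<Lambda> ^^ j) x) \<le> supn x"
    using supn_Lambda_pow_le order_trans by blast
qed

text \<open>\<open>L\<close> itself is a weighted composition sum.\<close>

lemma Lop_eq_comp_sum: "Lop \<rho> N B \<Lambda> \<phi> = comp_sum \<rho> {0..N} B (\<lambda>_. \<phi>) (\<lambda>j. (*v) \<Lambda> ^^ j)"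
  by (simp add: fun_eq_iff Lop_def comp_sum_def)

text \<open>The setting of the theorem. Writing \<open>L\<phi> = B\<^sub>0(\<phi> + K\<phi>)\<close> with
  \<open>K\<phi> = \<Sum>\<^sub>j\<^sub>\<ge>\<^sub>1 B\<^sub>0\<^sup>-\<^sup>1B\<^sub>j (\<phi> \<circ> \<Lambda>\<^sup>j)\<close>, hypotheses (1), (2) say that \<open>\<parallel>K\<parallel> \<le> \<kappa> < 1\<close>.\<close>

locale linearized_operator =
  fixes \<rho> :: real and r N :: nat and B :: "nat \<Rightarrow> real^'d^'d" and \<Lambda> :: "real^'m^'m" and \<mu> :: real
  assumes rho: "\<rho> > 0" and r: "r \<ge> 1" and B0: "invertible (B 0)"
    and Lambda_mu: "opnorm_inf \<Lambda> ^ r \<le> \<mu>" and mu_less_1: "\<mu> < 1"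
    and small: "(\<Sum>i=1..N. \<mu> ^ i * opnorm_inf (matrix_inv (B 0) ** B i)) < 1"
begin

definition \<kappa> :: real where "\<kappa> = (\<Sum>i=1..N. \<mu> ^ i * opnorm_inf (matrix_inv (B 0) ** B i))"

text \<open>Consequences of the hypotheses: \<open>\<parallel>\<Lambda>\<parallel> \<le> 1\<close> (as \<open>r \<ge> 1\<close>), \<open>\<mu> \<ge> 0\<close>, \<open>0 \<le> \<kappa> < 1\<close>.\<close>

lemma Lambda_le_1: "opnorm_inf \<Lambda> \<le> 1"
proof (rule ccontr)
  assume "\<not> opnorm_inf \<Lambda> \<le> 1"
  then have "1 < opnorm_inf \<Lambda> ^ r" using r by (intro one_less_power) auto
  then show False using Lambda_mu mu_less_1 by simp
qed

lemma mu_nonneg: "0 \<le> \<mu>"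
  using Lambda_mu zero_le_power[OF opnorm_nonneg, of \<Lambda> r] by linarith

lemma kappa_nonneg: "0 \<le> \<kappa>"
  unfolding \<kappa>_def by (intro sum_nonneg mult_nonneg_nonneg zero_le_power mu_nonneg opnorm_nonneg)

lemma kappa_less_1: "\<kappa> < 1"
  using small unfolding \<kappa>_def .

lemma Lop_in_Hr: "\<phi> \<in> Hr \<rho> r \<Longrightarrow> Lop \<rho> N B \<Lambda> \<phi> \<in> Hr \<rho> r"
  unfolding Lop_eq_comp_sum by (intro Hr_comp_sum[OF rho] nonexpanding_Lambda_pow[OF Lambda_le_1]) auto

text \<open>The equation \<open>L\<phi> = \<psi>\<close> is the fixed point equation \<open>\<phi> = B\<^sub>0\<^sup>-\<^sup>1\<psi> - K\<phi>\<close>.\<close>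

definition fixmap :: "(real^'m \<Rightarrow> real^'d) \<Rightarrow> (real^'m \<Rightarrow> real^'d) \<Rightarrow> real^'m \<Rightarrow> real^'d" where
  "fixmap \<psi> \<phi> = comp_sum \<rho> {0..N} (\<lambda>j. if j = 0 then matrix_inv (B 0) else - (matrix_inv (B 0) ** B j))
     (\<lambda>j. if j = 0 then \<psi> else \<phi>) (\<lambda>j. (*v) \<Lambda> ^^ j)"

text \<open>On \<open>H\<^sub>r\<close> the map is \<open>\<phi> \<mapsto> \<phi> + B\<^sub>0\<^sup>-\<^sup>1(\<psi> - L\<phi>)\<close>, so its fixed points solve \<open>L\<phi> = \<psi>\<close>.\<close>

lemma fixmap_eq:
  assumes "\<phi> \<in> Hr \<rho> r" "\<psi> \<in> Hr \<rho> r"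
  shows "fixmap \<psi> \<phi> x = \<phi> x + matrix_inv (B 0) *v (\<psi> x - Lop \<rho> N B \<Lambda> \<phi> x)"
proof (cases "x \<in> Dset \<rho>")
  case True
  define w where "w j = \<phi> (((*v) \<Lambda> ^^ j) x)" for j
  have inv: "matrix_inv (B 0) ** B 0 = mat 1" by (rule matrix_inv_left[OF B0])
  have "matrix_inv (B 0) *v Lop \<rho> N B \<Lambda> \<phi> x = \<phi> x + (\<Sum>j=1..N. (matrix_inv (B 0) ** B j) *v w j)"
    using True
    by (simp add: Lop_def w_def sum.atLeast_Suc_atMost matrix_vector_right_distrib matrix_vector_mul_assoc
        inv real_vector.linear_sum[OF matrix_vector_mul_linear])
  moreover have "fixmap \<psi> \<phi> x = matrix_inv (B 0) *v \<psi> x - (\<Sum>j=1..N. (matrix_inv (B 0) ** B j) *v w j)"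
    using True
    by (simp add: fixmap_def comp_sum_def w_def sum.atLeast_Suc_atMost matrix_vector_mult_uminus
        sum_negf[symmetric])
  ultimately show ?thesis by (simp add: matrix_vector_mult_diff_distrib)
qed (simp add: fixmap_def comp_sum_def Lop_def Hr_outside[OF rho assms(1)] Hr_outside[OF rho assms(2)])

lemma fixmap_fixed_iff:
  assumes "\<phi> \<in> Hr \<rho> r" "\<psi> \<in> Hr \<rho> r"
  shows "fixmap \<psi> \<phi> = \<phi> \<longleftrightarrow> Lop \<rho> N B \<Lambda> \<phi> = \<psi>"
proof -
  have "v = B 0 *v (matrix_inv (B 0) *v v)" for v
    by (simp add: matrix_vector_mul_assoc matrix_inv_right[OF B0])
  then have inj: "matrix_inv (B 0) *v v = 0 \<longleftrightarrow> v = 0" for v by (metis matrix_vector_mult_0_right)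
  show ?thesis by (auto simp: fun_eq_iff fixmap_eq[OF assms] inj)
qed

lemma fixmap_in_Hr: "\<phi> \<in> Hr \<rho> r \<Longrightarrow> \<psi> \<in> Hr \<rho> r \<Longrightarrow> fixmap \<psi> \<phi> \<in> Hr \<rho> r"
  unfolding fixmap_def by (intro Hr_comp_sum[OF rho] nonexpanding_Lambda_pow[OF Lambda_le_1]) auto

text \<open>The key estimate: \<open>\<parallel>B\<^sub>0\<^sup>-\<^sup>1\<psi> - K\<phi>\<parallel> \<le> \<parallel>B\<^sub>0\<^sup>-\<^sup>1\<parallel> \<parallel>\<psi>\<parallel> + \<kappa> \<parallel>\<phi>\<parallel>\<close>, since
  \<open>\<parallel>\<Lambda>\<^sup>j\<parallel>\<^sup>r \<le> \<mu>\<^sup>j\<close>.\<close>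

lemma Hnorm_fixmap_le:
  assumes \<phi>: "\<phi> \<in> Hr \<rho> r" and \<psi>: "\<psi> \<in> Hr \<rho> r"
  shows "Hnorm \<rho> r (fixmap \<psi> \<phi>) \<le> opnorm_inf (matrix_inv (B 0)) * Hnorm \<rho> r \<psi> + \<kappa> * Hnorm \<rho> r \<phi>"
proof -
  define a where "a j = (if j = 0 then opnorm_inf (matrix_inv (B 0)) else opnorm_inf (matrix_inv (B 0) ** B j))"
    for j
  have "Hnorm \<rho> r (fixmap \<psi> \<phi>)
      \<le> (\<Sum>j=0..N. a j * (opnorm_inf \<Lambda> ^ j) ^ r * Hnorm \<rho> r (if j = 0 then \<psi> else \<phi>))"
    unfolding fixmap_def
    by (rule Hnorm_comp_sum_le[OF rho])
      (auto simp: a_def \<phi> \<psi> nonexpanding_Lambda_pow[OF Lambda_le_1] supn_Lambda_pow_le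
        supn_matrix_le supn_neg_matrix_le opnorm_nonneg)
  also have "\<dots> = opnorm_inf (matrix_inv (B 0)) * Hnorm \<rho> r \<psi>
      + (\<Sum>j=1..N. a j * (opnorm_inf \<Lambda> ^ r) ^ j * Hnorm \<rho> r \<phi>)"
    by (simp add: sum.atLeast_Suc_atMost a_def power_mult[symmetric] mult.commute)
  also have "(\<Sum>j=1..N. a j * (opnorm_inf \<Lambda> ^ r) ^ j * Hnorm \<rho> r \<phi>) \<le> \<kappa> * Hnorm \<rho> r \<phi>"
    unfolding \<kappa>_def sum_distrib_right
  proof (intro sum_mono mult_right_mono Hnorm_nonneg[OF rho \<phi>])
    fix j assume "j \<in> {1..N}"
    then have "a j = opnorm_inf (matrix_inv (B 0) ** B j)" by (simp add: a_def)
    moreover have "(opnorm_inf \<Lambda> ^ r) ^ j \<le> \<mu> ^ j"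
      by (rule power_mono[OF Lambda_mu zero_le_power[OF opnorm_nonneg]])
    ultimately show "a j * (opnorm_inf \<Lambda> ^ r) ^ j \<le> \<mu> ^ j * opnorm_inf (matrix_inv (B 0) ** B j)"
      by (simp add: mult.commute mult_right_mono opnorm_nonneg)
  qed
  finally show ?thesis by simp
qed

text \<open>The difference of two images is an image of the difference, with \<open>\<psi>\<close> cancelled.\<close>

lemma fixmap_contraction:
  assumes "\<phi>1 \<in> Hr \<rho> r" "\<phi>2 \<in> Hr \<rho> r" "\<psi> \<in> Hr \<rho> r"
  shows "Hnorm \<rho> r (\<lambda>x. fixmap \<psi> \<phi>1 x - fixmap \<psi> \<phi>2 x) \<le> \<kappa> * Hnorm \<rho> r (\<lambda>x. \<phi>1 x - \<phi>2 x)"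
proof -
  have "(\<lambda>x. fixmap \<psi> \<phi>1 x - fixmap \<psi> \<phi>2 x) = fixmap (\<lambda>x. \<psi> x - \<psi> x) (\<lambda>x. \<phi>1 x - \<phi>2 x)"
    unfolding fixmap_def comp_sum_diff by (rule ext, rule arg_cong[where f="\<lambda>f. comp_sum _ _ _ f _ _"]) auto
  then show ?thesis
    using Hnorm_fixmap_le[OF Hr_diff[OF rho assms(1,2)] Hr_diff[OF rho assms(3,3)]]
      Hnorm_diff_self[OF rho assms(3)] by simp
qed

text \<open>By Banach's fixed point theorem in the complete space \<open>H\<^sub>r\<close>, \<open>L\<phi> = \<psi>\<close> has exactly
  one solution, and it satisfies \<open>\<parallel>\<phi>\<parallel> \<le> \<parallel>B\<^sub>0\<^sup>-\<^sup>1\<parallel> \<parallel>\<psi>\<parallel> / (1 - \<kappa>)\<close>.\<close>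

lemma unique_solution:
  assumes \<psi>: "\<psi> \<in> Hr \<rho> r"
  shows "\<exists>!\<phi>. \<phi> \<in> Hr \<rho> r \<and> Lop \<rho> N B \<Lambda> \<phi> = \<psi>"
proof -
  interpret complete_contraction "Hr \<rho> r" "\<lambda>f g. Hnorm \<rho> r (\<lambda>x. f x - g x)" "fixmap \<psi>" \<kappa>
  proof
    fix f g h :: "real^'m \<Rightarrow> real^'d"
    assume f: "f \<in> Hr \<rho> r"
    then show "fixmap \<psi> f \<in> Hr \<rho> r" by (rule fixmap_in_Hr[OF _ \<psi>])
    show "Hnorm \<rho> r (\<lambda>x. f x - f x) = 0" by (rule Hnorm_diff_self[OF rho f])
    assume g: "g \<in> Hr \<rho> r"
    show "Hnorm \<rho> r (\<lambda>x. f x - g x) = Hnorm \<rho> r (\<lambda>x. g x - f x)"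
      by (rule Hnorm_diff_commute[OF rho f g])
    show "Hnorm \<rho> r (\<lambda>x. fixmap \<psi> f x - fixmap \<psi> g x) \<le> \<kappa> * Hnorm \<rho> r (\<lambda>x. f x - g x)"
      by (rule fixmap_contraction[OF f g \<psi>])
    show "f = g" if "Hnorm \<rho> r (\<lambda>x. f x - g x) \<le> 0"
      using Hnorm_eq_0_imp_zero[OF rho Hr_diff[OF rho f g] that] by (simp add: fun_eq_iff)
    assume h: "h \<in> Hr \<rho> r"
    show "Hnorm \<rho> r (\<lambda>x. f x - h x) \<le> Hnorm \<rho> r (\<lambda>x. f x - g x) + Hnorm \<rho> r (\<lambda>x. g x - h x)"
      by (rule Hnorm_diff_triangle[OF rho f g h])
  next
    show "\<exists>x\<in>Hr \<rho> r. \<forall>n. Hnorm \<rho> r (\<lambda>y. s n y - x y) \<le> e n"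
      if "\<And>n. s n \<in> Hr \<rho> r" "\<And>n m. n \<le> m \<Longrightarrow> Hnorm \<rho> r (\<lambda>x. s m x - s n x) \<le> e n" "e \<longlonglongrightarrow> 0"
      for s :: "nat \<Rightarrow> real^'m \<Rightarrow> real^'d" and e
      by (rule Hr_complete[OF rho that])
  qed (rule kappa_nonneg, rule kappa_less_1)
  show ?thesis
    using fixpoint_exists[OF \<psi>] fixpoint_unique fixmap_fixed_iff[OF _ \<psi>] by metis
qed

lemma solution_bound:
  assumes \<phi>: "\<phi> \<in> Hr \<rho> r"
  shows "Hnorm \<rho> r \<phi> \<le> opnorm_inf (matrix_inv (B 0)) / (1 - \<kappa>) * Hnorm \<rho> r (Lop \<rho> N B \<Lambda> \<phi>)"
proof -
  have "fixmap (Lop \<rho> N B \<Lambda> \<phi>) \<phi> = \<phi>" using fixmap_fixed_iff[OF \<phi> Lop_in_Hr[OF \<phi>]] by simp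
  then have "Hnorm \<rho> r \<phi> \<le> opnorm_inf (matrix_inv (B 0)) * Hnorm \<rho> r (Lop \<rho> N B \<Lambda> \<phi>) + \<kappa> * Hnorm \<rho> r \<phi>"
    using Hnorm_fixmap_le[OF \<phi> Lop_in_Hr[OF \<phi>]] by simp
  then show ?thesis using kappa_less_1 by (simp add: field_simps)
qed

end

text \<open>The theorem: \<open>L\<close> maps \<open>H\<^sub>r\<close> into itself, bijectively, with inverse bounded by
  \<open>C = \<parallel>B\<^sub>0\<^sup>-\<^sup>1\<parallel> / (1 - \<kappa>)\<close>.\<close>

theorem mainTheorem13:
  fixes \<rho> \<mu> :: real and r N :: nat
    and B :: "nat \<Rightarrow> real^'d^'d" and \<Lambda> :: "real^'m^'m"
  assumes "\<rho> > 0" and "r \<ge> 1" and "invertible (B 0)"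
    and "opnorm_inf \<Lambda> ^ r \<le> \<mu>" and "\<mu> < 1"
    and "(\<Sum>i=1..N. \<mu> ^ i * opnorm_inf (matrix_inv (B 0) ** B i)) < 1"
  shows "(\<forall>\<phi>\<in>Hr \<rho> r. Lop \<rho> N B \<Lambda> \<phi> \<in> Hr \<rho> r)
    \<and> bij_betw (Lop \<rho> N B \<Lambda>) (Hr \<rho> r) (Hr \<rho> r)
    \<and> (\<exists>C. \<forall>\<psi>\<in>Hr \<rho> r.
          Hnorm \<rho> r (inv_into (Hr \<rho> r) (Lop \<rho> N B \<Lambda>) \<psi>) \<le> C * Hnorm \<rho> r \<psi>)"
proof -
  interpret linearized_operator \<rho> r N B \<Lambda> \<mu> using assms by unfold_locales
  have into: "\<forall>\<phi>\<in>Hr \<rho> r. Lop \<rho> N B \<Lambda> \<phi> \<in> Hr \<rho> r" using Lop_in_Hr by blast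
  have bij: "bij_betw (Lop \<rho> N B \<Lambda>) (Hr \<rho> r) (Hr \<rho> r)"
    unfolding bij_betw_def inj_on_def using into unique_solution by blast
  have "Hnorm \<rho> r (inv_into (Hr \<rho> r) (Lop \<rho> N B \<Lambda>) \<psi>)
      \<le> opnorm_inf (matrix_inv (B 0)) / (1 - \<kappa>) * Hnorm \<rho> r \<psi>" if \<psi>: "\<psi> \<in> Hr \<rho> r" for \<psi>
  proof -
    have "\<psi> \<in> Lop \<rho> N B \<Lambda> ` Hr \<rho> r" using bij \<psi> by (simp add: bij_betw_def)
    then show ?thesis
      using solution_bound[OF inv_into_into] f_inv_into_f by metis
  qed
  then show ?thesis using into bij by blast
qed

end
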